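(* For every $n,s\in\mathbb{N}$ and $0<p<q\leq\infty$, the following relation holds: $$\sup_{\substack{T_n\in\mathcal{T}_n,\\ \|T_n\|_p^*=1}}\big\|T_n^{(s)}\big\|_q^* \asymp_{p,q} n^s\left(1+\left(\frac{n}{s}\right)^{\frac1p-\frac1q}\right).$$
   Context: $\mathcal{T}_n$ is the space of all trigonometric polynomials $T_n(x)=\sum_{k=-n}^n c_k e^{ikx}$ of degree at most $n$ with complex coefficients. For $p\in(0,\infty)$, $\|f\|_p^*:=\left(\int_{-\pi}^{\pi}|f(x)|^p\,dx\right)^{1/p}$, and $\|f\|_\infty^*$ is the (essential) supremum of $|f|$ on $[-\pi,\pi]$. By convention $1/\infty=0$. $T^{(s)}$ denotes the $s$-th derivative. The notation $A\asymp_{p,q}B$ means that there are constants $C_1,C_2>0$ depending only on $p$ and $q$ (in particular independent of $n$ and $s$) such that $C_2B\le A\le C_1B$. *)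

theory Defs
  imports "HOL-Probability.Essential_Supremum"
begin

definition trig_polys :: "nat \<Rightarrow> (real \<Rightarrow> complex) set" where
  "trig_polys n = {T. \<exists>c :: int \<Rightarrow> complex.
     T = (\<lambda>x. \<Sum>k = - int n..int n. c k * exp (\<i> * of_int k * of_real x))}"

text \<open>
  The (quasi-)norm over one period, for an exponent in \<open>(0, \<infinity>]\<close>, with values in the extended
  reals; it is \<open>\<infinity>\<close> outside the corresponding space. In particular \<^const>\<open>esssup\<close> is \<open>\<infinity>\<close> for
  non-measurable functions, and the integrability test avoids the library convention that a
  non-existing integral is \<open>0\<close>.
\<close>

definition per_norm :: "ereal \<Rightarrow> (real \<Rightarrow> complex) \<Rightarrow> ereal" where
  "per_norm p f =
     (if p = \<infinity> then esssup (lebesgue_on {-pi..pi}) (\<lambda>x. ereal (cmod (f x)))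
      else let r = real_of_ereal p in
        if integrable (lebesgue_on {-pi..pi}) (\<lambda>x. cmod (f x) powr r)
        then ereal ((\<integral>x. cmod (f x) powr r \<partial>lebesgue_on {-pi..pi}) powr (1 / r))
        else \<infinity>)"

text \<open>
  The library's \<^const>\<open>deriv\<close> needs equal domain and codomain, so functions of a real variable with
  complex values are differentiated by \<^const>\<open>vector_derivative\<close>.
\<close>

definition nth_deriv :: "nat \<Rightarrow> (real \<Rightarrow> complex) \<Rightarrow> real \<Rightarrow> complex" where
  "nth_deriv s = (\<lambda>f x. vector_derivative f (at x)) ^^ s"

end

theory Submission
  imports Defs "HOL-Complex_Analysis.Complex_Analysis"
begin

text \<open>
  Write \<open>p = r\<close> (it is finite, since \<open>p < q\<close>) and \<open>R = s / n\<close>, and let \<open>P\<^sub>b\<close> be the \<open>2\<pi>\<close>-periodic Poisson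
  kernel of height \<open>b\<close>, normalised to have mass \<open>1\<close>. A trigonometric polynomial extends to an entire
  function \<open>T\<close>, and the upper bound rests on a pointwise estimate with a constant \<open>K\<close> that depends on
  \<open>r\<close> only (\<open>higher_deriv_le_poisson_mean\<close>): the modulus of the \<open>s\<close>-th derivative of \<open>T\<close> at \<open>x\<close> is at most
  \<open>K n\<^sup>s\<close> times the \<open>r\<close>-th root of \<open>J(x)\<close>, where \<open>J\<close> is the convolution of \<open>|T|\<^sup>r\<close> with \<open>P\<^sub>R\<close>. For a normalised \<open>T\<close>,
  the function \<open>J\<close> has integral \<open>1\<close>, and it is bounded by a multiple of \<open>1 + n/s\<close>, because \<open>P\<^sub>R\<close> is.
  Interpolation between these two facts gives the upper bound for all \<open>q > r\<close> at once.

  For the pointwise estimate, \<open>exp (i n z) T(z)\<close> is a polynomial in \<open>w = exp (i z)\<close>, and the \<open>r\<close>-th power of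
  the modulus of a polynomial lies below the Poisson integral of its boundary values, for every
  \<open>r > 0\<close>: reflect the zeros inside the unit disc across the circle, and take an \<open>r\<close>-th power of the
  resulting function, which has no zeros in the disc (\<open>poly_powr_le_poisson\<close>). Hence \<open>|T(x + i b)|\<^sup>r\<close> is at most
  \<open>exp (r n |b|)\<close> times the convolution of \<open>|T|\<^sup>r\<close> with the kernel of height \<open>|b|\<close>.

  Insert this into Cauchy's formula for the \<open>s\<close>-th derivative at \<open>x\<close> on the circle of radius \<open>R\<close>. Its
  prefactor \<open>s! / R\<^sup>s\<close> equals \<open>n\<^sup>s s! / s\<^sup>s\<close>, which by Stirling's formula is about \<open>n\<^sup>s exp (- s) \<surd>s\<close>. At the
  point of angle \<open>t\<close> the growth factor involves \<open>n |b| = s |sin t|\<close>, and the mean of \<open>exp (s |sin t|)\<close> over the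
  circle is about \<open>exp s / \<surd>s\<close>. So the exponentials and the square roots cancel, and the constant does
  not depend on \<open>s\<close>. Harnack's inequality replaces all the kernels by multiples of \<open>P\<^sub>R\<close>. This loses a
  factor \<open>|sin t|\<close> to the power \<open>- 1/r\<close>, which need not be integrable near the real axis. The remedy is
  to multiply the integrand by a power of \<open>1 - ((z - x)/R)\<^sup>2\<^sup>s\<close>, which leaves the Taylor coefficient of order \<open>s\<close>
  unchanged and vanishes at the two real points of the circle.

  For the lower bound, take the Dirichlet-type sum \<open>D(x) = (\<Sum>j<m. exp (i j x))\<close>, a power \<open>N\<close> with \<open>N r \<ge> 2\<close>,
  and \<open>T(x) = exp (i (n - d) x) D(x)\<^sup>N\<close>, where \<open>d = N (m - 1)\<close> and \<open>m\<close> has the size of \<open>1 + n / (2 s N)\<close>. All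
  frequencies are at least \<open>n (1 - 1/(2s))\<close>, so that each coefficient gains at least a factor \<open>n\<^sup>s / 2\<close>
  when \<open>T\<close> is differentiated \<open>s\<close> times. The coefficients are nonnegative, so they do not cancel on an
  interval of length about \<open>1/m\<close> around \<open>0\<close>; the norm of \<open>T\<close> is no larger than that of a
  bump of height \<open>m\<^sup>N\<close> on an interval of this length, up to a constant.
\<close>

section \<open>The Poisson kernel\<close>

lemma has_integral_shift_pi:
  fixes f :: "real \<Rightarrow> complex"
  assumes "(f has_integral I) {0..2 * pi}"
  shows "((\<lambda>t. f (t + pi)) has_integral I) {- pi..pi}"
proof -
  from assms have "(f has_integral I) (cbox 0 (2 * pi))" by simp
  from has_integral_affinity[OF this, of 1 pi]
  have "((\<lambda>t. f (t + pi)) has_integral I) ((\<lambda>x. x - pi) ` {0..2 * pi})"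
    by simp
  also have "(\<lambda>x. x - pi) ` {0..2 * pi} = {- pi..pi}"
    using image_add_atLeastAtMost'[of "-pi" 0 "2*pi"] by simp
  finally show ?thesis .
qed

text \<open>
  Cauchy's integral formula at \<open>w\<close> for \<open>H(\<zeta>) (1 - |w|\<^sup>2) / (1 - w' \<zeta>)\<close>, where \<open>w'\<close> is the conjugate of \<open>w\<close>: the
  additional factor is \<open>1\<close> at \<open>w\<close> and turns the Cauchy kernel on the circle into the Poisson kernel.
\<close>
lemma poisson_formula_aux:
  assumes H: "H holomorphic_on ball 0 \<rho>" and \<rho>: "1 < \<rho>" and w: "cmod w < 1"
  shows "((\<lambda>t. H (cis t) * of_real ((1 - (cmod w)\<^sup>2) / (cmod (cis t - w))\<^sup>2)) has_integral
           2 * of_real pi * H w) {0..2 * pi}"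
proof -
  define K where "K = (\<lambda>\<zeta>. H \<zeta> * of_real (1 - (cmod w)\<^sup>2) / (1 - cnj w * \<zeta>))"
  have nz: "1 - cnj w * \<zeta> \<noteq> 0" if "cmod \<zeta> \<le> 1" for \<zeta>
  proof
    assume "1 - cnj w * \<zeta> = 0"
    then have "1 = cmod w * cmod \<zeta>" by (metis complex_mod_cnj eq_iff_diff_eq_0 norm_mult norm_one)
    also have "\<dots> \<le> cmod w * 1" by (intro mult_left_mono that) auto
    finally show False using w by simp
  qed
  have "K holomorphic_on cball 0 1"
    unfolding K_def using nz \<rho>
    by (intro holomorphic_intros holomorphic_on_subset[OF H]) auto
  then have "((\<lambda>u. K u / (u - w)) has_contour_integral (2 * of_real pi * \<i> * K w)) (circlepath 0 1)"
    by (rule Cauchy_integral_circlepath_simple) (use w in simp)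
  then have "((\<lambda>t. K (cis t) / (cis t - w) * \<i> * cis t) has_integral (2 * of_real pi * \<i> * K w)) {0..2 * pi}"
    unfolding circlepath_def by (subst (asm) has_contour_integral_part_circlepath_iff) (simp_all add: mult_ac)
  then have *: "((\<lambda>t. (- \<i>) * (K (cis t) / (cis t - w) * \<i> * cis t)) has_integral
      (- \<i>) * (2 * of_real pi * \<i> * K w)) {0..2 * pi}"
    by (rule has_integral_mult_right)
  have Kw: "K w = H w"
  proof -
    have "cnj w * w = of_real ((cmod w)\<^sup>2)"
      by (metis complex_norm_square mult.commute)
    then show ?thesis unfolding K_def using nz[of w] w by (simp add: field_simps)
  qed
  have eq: "(- \<i>) * (K (cis t) / (cis t - w) * \<i> * cis t)
      = H (cis t) * of_real ((1 - (cmod w)\<^sup>2) / (cmod (cis t - w))\<^sup>2)" for t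
  proof -
    have 1: "1 - cnj w * cis t = cis t * cnj (cis t - w)"
      by (simp add: algebra_simps cis_cnj cis_mult)
    have nz': "cis t - w \<noteq> 0" using w by auto
    have 2: "complex_of_real ((cmod (cis t - w))\<^sup>2) = (cis t - w) * cnj (cis t - w)"
      by (rule complex_norm_square)
    show ?thesis
      unfolding K_def 1 of_real_divide 2 using nz' by (simp add: divide_simps) (simp add: algebra_simps)
  qed
  show ?thesis using * unfolding eq Kw by (simp add: mult_ac)
qed

lemma poisson_formula:
  assumes H: "H holomorphic_on ball 0 \<rho>" and \<rho>: "1 < \<rho>" and w: "cmod w < 1"
  shows "((\<lambda>t. H (cis t) * of_real ((1 - (cmod w)\<^sup>2) / (cmod (cis t - w))\<^sup>2)) has_integral
           2 * of_real pi * H w) {- pi..pi}"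
proof -
  have "(\<lambda>z. H (- z)) holomorphic_on ball 0 \<rho>"
    by (rule holomorphic_on_compose_gen[of "\<lambda>z. - z" _ H, unfolded o_def, OF _ H])
      (auto intro!: holomorphic_intros)
  from poisson_formula_aux[OF this \<rho>, of "- w"] w
  have "((\<lambda>t. H (- cis t) * of_real ((1 - (cmod w)\<^sup>2) / (cmod (- cis t - w))\<^sup>2)) has_integral
           2 * of_real pi * H w) {0..2 * pi}" (is "(?f has_integral _) _")
    by (simp add: norm_minus_commute[of "- cis _"] norm_minus_commute[of _ "- w"] add.commute)
  from has_integral_shift_pi[OF this]
  have "((\<lambda>t. ?f (t + pi)) has_integral 2 * of_real pi * H w) {- pi..pi}" .
  also have "(\<lambda>x. ?f (x + pi)) = (\<lambda>t. H (cis t) * of_real ((1 - (cmod w)\<^sup>2) / (cmod (cis t - w))\<^sup>2))"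
    by (simp add: cis_mult [symmetric])
  finally show ?thesis .
qed

text \<open>
  The kernel \<open>(1 - \<rho>\<^sup>2) / (1 - 2 \<rho> cos \<theta> + \<rho>\<^sup>2)\<close> of the unit disc for \<open>\<rho> = exp (- b)\<close>. The height \<open>b\<close> is the
  imaginary part that corresponds to the radius \<open>\<rho>\<close> under \<open>w = exp (i z)\<close>.
\<close>
definition poisson_kernel :: "real \<Rightarrow> real \<Rightarrow> real" where
  "poisson_kernel b \<theta> = sinh b / (cosh b - cos \<theta>)"

lemma poisson_kernel_denom_pos: "0 < b \<Longrightarrow> 0 < cosh b - cos (\<theta>::real)"
  using cosh_real_strict_mono[of 0 b] cos_le_one[of \<theta>] by (simp del: cos_le_one)

lemma poisson_kernel_pos: "0 < b \<Longrightarrow> 0 < poisson_kernel b \<theta>"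
  unfolding poisson_kernel_def using poisson_kernel_denom_pos by auto

lemma poisson_kernel_disc:
  assumes "0 < b" "w = of_real (exp (- b)) * cis x"
  shows "(1 - (cmod w)\<^sup>2) / (cmod (cis t - w))\<^sup>2 = poisson_kernel b (t - x)"
proof -
  have 1: "cmod w = exp (- b)" unfolding assms by (simp add: norm_mult)
  have "(cmod (cis t - w))\<^sup>2 = (cos t - exp (-b) * cos x)\<^sup>2 + (sin t - exp (-b) * sin x)\<^sup>2"
    unfolding assms by (simp add: cmod_power2)
  also have "\<dots> = (cos t)\<^sup>2 + (sin t)\<^sup>2 + (exp (-b))\<^sup>2 * ((cos x)\<^sup>2 + (sin x)\<^sup>2)
      - 2 * exp (-b) * cos (t - x)"
    unfolding cos_diff by algebra
  also have "\<dots> = 1 + (exp (-b))\<^sup>2 - 2 * exp (-b) * cos (t - x)"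
    by (simp only: sin_cos_squared_add2 mult_1_right)
  also have "\<dots> = 2 * exp (-b) * (cosh b - cos (t - x))"
    by (simp add: cosh_field_def algebra_simps power2_eq_square mult_exp_exp)
  finally have 2: "(cmod (cis t - w))\<^sup>2 = 2 * exp (-b) * (cosh b - cos (t - x))" .
  have 3: "1 - (cmod w)\<^sup>2 = 2 * exp (-b) * sinh b"
    unfolding 1 by (simp add: sinh_field_def algebra_simps power2_eq_square mult_exp_exp)
  show ?thesis unfolding 2 3 poisson_kernel_def by simp
qed

lemma poisson_kernel_integral:
  assumes "0 < b"
  shows "((\<lambda>t. poisson_kernel b (t - x)) has_integral 2 * pi) {- pi..pi}"
proof -
  define w where "w = complex_of_real (exp (- b)) * cis x"
  have "cmod w < 1" unfolding w_def using assms by (simp add: norm_mult)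
  from poisson_formula[of "\<lambda>_. 1" 2, OF _ _ this]
  have "((\<lambda>t. complex_of_real (poisson_kernel b (t - x))) has_integral complex_of_real (2 * pi)) {- pi..pi}"
    by (simp add: poisson_kernel_disc[OF assms w_def] holomorphic_intros)
  then show ?thesis using has_integral_linear[OF _ bounded_linear_Re] by (force simp: o_def)
qed

lemma continuous_on_poisson_kernel:
  fixes f :: "'a::t2_space \<Rightarrow> real"
  assumes "0 < b" "continuous_on S f"
  shows "continuous_on S (\<lambda>x. poisson_kernel b (f x))"
  unfolding poisson_kernel_def
proof (intro continuous_intros assms ballI)
  show "cosh b - cos (f x) \<noteq> 0" for x
    using poisson_kernel_denom_pos[OF assms(1), of "f x"] by simp
qed

lemma poisson_kernel_le:
  assumes "0 < b"
  shows "poisson_kernel b \<theta> \<le> 1 + 2 / b"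
proof -
  define e where "e = exp b"
  have e: "e \<ge> 1 + b" unfolding e_def by (rule exp_ge_add_one_self)
  have "poisson_kernel b \<theta> \<le> sinh b / (cosh b - 1)"
    unfolding poisson_kernel_def using assms poisson_kernel_denom_pos[of b 0]
    by (intro divide_left_mono mult_pos_pos poisson_kernel_denom_pos) auto
  also have "\<dots> = (e + 1) / (e - 1)"
  proof -
    have "sinh b * (e - 1) = (e + 1) * (cosh b - 1)"
      unfolding sinh_field_def cosh_field_def exp_minus e_def by (simp add: field_simps)
    then show ?thesis using poisson_kernel_denom_pos[of b 0] assms e by (simp add: frac_eq_eq)
  qed
  also have "\<dots> = 1 + 2 / (e - 1)" using e assms by (simp add: field_simps)
  also have "\<dots> \<le> 1 + 2 / b" using e assms by (simp add: frac_le)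
  finally show ?thesis .
qed

lemma x_le_sinh:
  assumes "0 \<le> (x::real)"
  shows "x \<le> sinh x"
  using real_le_x_sinh[OF assms] by (simp add: sinh_field_def exp_minus)

text \<open>
  Monotonicity of \<open>x coth x\<close>, with the denominators cleared.
\<close>
lemma x_coth_mono:
  assumes "0 < x" "x \<le> (y::real)"
  shows "x * cosh x * sinh y \<le> y * cosh y * sinh x"
proof -
  have "x * cosh x / sinh x \<le> y * cosh y / sinh y"
  proof (rule DERIV_nonneg_imp_nondecreasing[OF assms(2)])
    fix u assume "x \<le> u" "u \<le> y"
    then have u: "0 < u" "0 < sinh u" using assms by auto
    have "u * 1 \<le> sinh u * cosh u"
      using u x_le_sinh[of u] by (intro mult_mono) (auto simp: cosh_real_ge_1)
    then have "0 \<le> (sinh u * cosh u - u * ((cosh u)\<^sup>2 - (sinh u)\<^sup>2)) / (sinh u)\<^sup>2"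
      by (simp add: cosh_square_eq)
    moreover have "((\<lambda>u. u * cosh u / sinh u) has_real_derivative
        (sinh u * cosh u - u * ((cosh u)\<^sup>2 - (sinh u)\<^sup>2)) / (sinh u)\<^sup>2) (at u)"
      using u by (auto intro!: derivative_eq_intros simp: power2_eq_square algebra_simps)
    ultimately show "\<exists>z. ((\<lambda>u. u * cosh u / sinh u) has_real_derivative z) (at u) \<and> 0 \<le> z"
      by blast
  qed
  then show ?thesis using assms by (simp add: field_simps)
qed

lemma cosh_minus_cos_half: "cosh b - cos \<theta> = 2 * (sinh (b / 2))\<^sup>2 + 2 * (sin (\<theta> / 2))\<^sup>2" for b :: real
  using cosh_double[of "b / 2"] cos_double_sin[of "\<theta> / 2"]
  by (simp add: cosh_square_eq)

text \<open>
  Harnack's inequality in explicit form: lowering the pole from height \<open>R\<close> to \<open>b\<close> and moving it sideways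
  by at most \<open>R\<close> costs a factor comparable to \<open>R / b\<close>. The half-angle form of the denominators allows a
  comparison term by term, in which \<open>|sin (a/2)| \<le> sinh (R/2)\<close> absorbs the sideways shift.
\<close>
lemma poisson_kernel_harnack:
  assumes "0 < b" "b \<le> R" "\<bar>a\<bar> \<le> R"
  shows "poisson_kernel b (\<theta> - a) \<le> 3 * (R / b) * poisson_kernel R \<theta>"
proof -
  have R: "0 < R" using assms by linarith
  define u where "u = (sin ((\<theta> - a) / 2))\<^sup>2"
  have "\<bar>sin (\<theta> / 2)\<bar> \<le> \<bar>sin ((\<theta> - a) / 2)\<bar> + \<bar>sin (a / 2)\<bar>"
  proof -
    have "sin (\<theta> / 2) = sin ((\<theta> - a) / 2 + a / 2)" by (simp add: diff_divide_distrib)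
    also have "\<dots> = sin ((\<theta> - a) / 2) * cos (a / 2) + cos ((\<theta> - a) / 2) * sin (a / 2)"
      by (rule sin_add)
    also have "\<bar>\<dots>\<bar> \<le> \<bar>sin ((\<theta> - a) / 2)\<bar> * \<bar>cos (a / 2)\<bar> + \<bar>cos ((\<theta> - a) / 2)\<bar> * \<bar>sin (a / 2)\<bar>"
      by (metis abs_mult abs_triangle_ineq)
    also have "\<dots> \<le> \<bar>sin ((\<theta> - a) / 2)\<bar> * 1 + 1 * \<bar>sin (a / 2)\<bar>"
      by (intro add_mono mult_mono) auto
    finally show ?thesis by simp
  qed
  also have "\<bar>sin (a / 2)\<bar> \<le> sinh (R / 2)"
    using abs_sin_x_le_abs_x[of "a / 2"] assms x_le_sinh[of "R / 2"] by simp
  finally have "(sin (\<theta> / 2))\<^sup>2 \<le> (\<bar>sin ((\<theta> - a) / 2)\<bar> + sinh (R / 2))\<^sup>2"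
    by (intro abs_le_square_iff[THEN iffD1]) (use R in auto)
  also have "\<dots> \<le> 2 * u + 2 * (sinh (R / 2))\<^sup>2"
    using sum_squares_bound[of "\<bar>sin ((\<theta> - a) / 2)\<bar>" "sinh (R / 2)"]
    unfolding u_def power2_sum by simp
  finally have 1: "cosh R - cos \<theta> \<le> 6 * (sinh (R / 2))\<^sup>2 + 6 * u"
    unfolding cosh_minus_cos_half using zero_le_power2[of "sin ((\<theta> - a) / 2)"] unfolding u_def by linarith
  have dbl: "sinh c = 2 * sinh (c / 2) * cosh (c / 2)" for c :: real
    using sinh_double[of "c / 2"] by simp
  have 2: "b * sinh b \<le> R * sinh R"
    using assms R by (intro mult_mono) auto
  have "(b / 2) * cosh (b / 2) * sinh (R / 2) \<le> (R / 2) * cosh (R / 2) * sinh (b / 2)"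
    by (rule x_coth_mono) (use assms in auto)
  then have "((b / 2) * cosh (b / 2) * sinh (R / 2)) * (4 * sinh (b / 2) * sinh (R / 2))
      \<le> ((R / 2) * cosh (R / 2) * sinh (b / 2)) * (4 * sinh (b / 2) * sinh (R / 2))"
    by (rule mult_right_mono) (use assms R in auto)
  then have 3: "b * sinh b * (sinh (R / 2))\<^sup>2 \<le> R * sinh R * (sinh (b / 2))\<^sup>2"
    unfolding dbl[of b] dbl[of R] by (simp add: power2_eq_square mult_ac)
  have "b * sinh b * (cosh R - cos \<theta>) \<le> b * sinh b * (6 * (sinh (R / 2))\<^sup>2 + 6 * u)"
    using assms by (intro mult_left_mono 1) auto
  also have "\<dots> \<le> 6 * (R * sinh R * (sinh (b / 2))\<^sup>2) + 6 * (R * sinh R * u)"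
    using 3 mult_right_mono[OF 2, of u] by (simp add: u_def algebra_simps)
  also have "\<dots> = 3 * R * sinh R * (cosh b - cos (\<theta> - a))"
    unfolding cosh_minus_cos_half u_def by (simp add: algebra_simps)
  finally show ?thesis
    unfolding poisson_kernel_def
    using poisson_kernel_denom_pos[OF assms(1), of "\<theta> - a"] poisson_kernel_denom_pos[OF R, of \<theta>] assms(1)
    by (simp add: field_simps)
qed

section \<open>Powers of polynomials lie below their Poisson integrals\<close>

text \<open>
  Each factor \<open>w - a\<close> with \<open>|a| < 1\<close> is replaced by \<open>1 - a' w\<close>, with \<open>a'\<close> the conjugate of \<open>a\<close>. The quotient of
  the two is a Blaschke factor, of modulus \<open>1\<close> on the circle and less than \<open>1\<close> inside.
\<close>
lemma blaschke_reflection: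
  fixes F :: "complex poly"
  assumes "F \<noteq> 0"
  obtains G where "G holomorphic_on UNIV" "\<And>w. cmod w < 1 \<Longrightarrow> G w \<noteq> 0"
    "\<And>w. cmod w = 1 \<Longrightarrow> cmod (G w) = cmod (poly F w)"
    "\<And>w. cmod w < 1 \<Longrightarrow> cmod (poly F w) \<le> cmod (G w)"
  using assms
proof (induction "degree F" arbitrary: F thesis rule: less_induct)
  case less
  show ?case
  proof (cases "\<exists>a. cmod a < 1 \<and> poly F a = 0")
    case False
    show ?thesis
      by (rule less.prems(1)[of "poly F"]) (use False in \<open>auto intro!: holomorphic_intros\<close>)
  next
    case True
    then obtain a where a: "cmod a < 1" "poly F a = 0" by blast
    then obtain F1 where F1: "F = [:- a, 1:] * F1" by (auto simp: poly_eq_0_iff_dvd)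
    with less.prems(2) have F1nz: "F1 \<noteq> 0" by auto
    then have "degree F1 < degree F" unfolding F1 by (subst degree_mult_eq) auto
    from less.hyps[OF this _ F1nz] obtain G where G: "G holomorphic_on UNIV" "\<And>w. cmod w < 1 \<Longrightarrow> G w \<noteq> 0"
      "\<And>w. cmod w = 1 \<Longrightarrow> cmod (G w) = cmod (poly F1 w)"
      "\<And>w. cmod w < 1 \<Longrightarrow> cmod (poly F1 w) \<le> cmod (G w)" by blast
    have key: "(cmod (1 - cnj a * w))\<^sup>2 - (cmod (w - a))\<^sup>2 = (1 - (cmod a)\<^sup>2) * (1 - (cmod w)\<^sup>2)" for w
      unfolding cmod_power2 by (simp add: power2_eq_square algebra_simps)
    have polyF: "poly F w = (w - a) * poly F1 w" for w
      unfolding F1 by (simp add: algebra_simps)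
    show ?thesis
    proof (rule less.prems(1)[of "\<lambda>w. (1 - cnj a * w) * G w"])
      show "(\<lambda>w. (1 - cnj a * w) * G w) holomorphic_on UNIV"
        by (intro holomorphic_intros G)
    next
      fix w assume w: "cmod w < 1"
      have "cmod (cnj a * w) < 1"
        using a(1) w mult_left_le[OF less_imp_le[OF w] norm_ge_zero[of a]] unfolding norm_mult complex_mod_cnj by linarith
      then have "1 - cnj a * w \<noteq> 0" by force
      then show "(1 - cnj a * w) * G w \<noteq> 0" using G w by simp
      have "0 \<le> (1 - (cmod a)\<^sup>2) * (1 - (cmod w)\<^sup>2)"
        using a w by (intro mult_nonneg_nonneg) (auto simp: power_le_one)
      then have "(cmod (w - a))\<^sup>2 \<le> (cmod (1 - cnj a * w))\<^sup>2"
        using key[of w] by linarith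
      then have "cmod (w - a) \<le> cmod (1 - cnj a * w)"
        by (rule power2_le_imp_le) simp
      then show "cmod (poly F w) \<le> cmod ((1 - cnj a * w) * G w)"
        unfolding polyF norm_mult by (rule mult_mono[OF _ G(4)[OF w]]) simp_all
    next
      fix w assume w: "cmod w = 1"
      have "(cmod (w - a))\<^sup>2 = (cmod (1 - cnj a * w))\<^sup>2"
        using key[of w] unfolding w by simp
      then have "cmod (w - a) = cmod (1 - cnj a * w)"
        by (rule power2_eq_imp_eq) simp_all
      then show "cmod ((1 - cnj a * w) * G w) = cmod (poly F w)"
        unfolding polyF norm_mult G(3)[OF w] by simp
    qed
  qed
qed

text \<open>
  The reflected function \<open>G\<close> has a logarithm in the open disc, so that \<open>G\<close> to the power \<open>p\<close> makes sense there
  and satisfies the Poisson formula. But \<open>G\<close> may have zeros on the circle, so the formula is applied to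
  the dilates \<open>G(\<rho> w)\<close> with \<open>\<rho> < 1\<close>, followed by a passage to the limit \<open>\<rho> \<rightarrow> 1\<close>.
\<close>
lemma poly_powr_le_poisson:
  assumes p: "0 < p" and w: "cmod w < 1"
  shows "2 * pi * cmod (poly F w) powr p \<le>
    integral {- pi..pi} (\<lambda>t. cmod (poly F (cis t)) powr p * ((1 - (cmod w)\<^sup>2) / (cmod (cis t - w))\<^sup>2))"
proof (cases "F = 0")
  case False
  obtain G where G: "G holomorphic_on UNIV" "\<And>w. cmod w < 1 \<Longrightarrow> G w \<noteq> 0"
    "\<And>w. cmod w = 1 \<Longrightarrow> cmod (G w) = cmod (poly F w)"
    "\<And>w. cmod w < 1 \<Longrightarrow> cmod (poly F w) \<le> cmod (G w)"
    using blaschke_reflection[OF False] by metis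
  have "G holomorphic_on ball 0 1" using G(1) holomorphic_on_subset by blast
  then obtain g where g: "g holomorphic_on ball 0 1" "\<And>z. z \<in> ball 0 1 \<Longrightarrow> G z = exp (g z)"
    by (rule contractible_imp_holomorphic_log) (use G(2) in \<open>auto intro: convex_imp_contractible\<close>)
  define k where "k = (\<lambda>t. (1 - (cmod w)\<^sup>2) / (cmod (cis t - w))\<^sup>2)"
  have nz: "cis t - w \<noteq> 0" for t using w by auto
  have k0: "0 \<le> k t" for t using w unfolding k_def by (auto intro!: divide_nonneg_nonneg simp: power_le_one)
  define I where "I = (\<lambda>\<rho>. integral (cbox (- pi) pi) (\<lambda>t. cmod (G (of_real \<rho> * cis t)) powr p * k t))"
  have contG: "continuous_on S (\<lambda>x. G (h x))" if "continuous_on S h" for h and S :: "'a::topological_space set"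
    by (rule continuous_on_compose2[OF holomorphic_on_imp_continuous_on[OF G(1)] that]) auto
  have cont: "continuous_on S (\<lambda>x. cmod (G (h x)) powr p)" if "continuous_on S h" for h and S :: "'a::topological_space set"
    using p by (intro continuous_on_powr' continuous_intros contG that) auto
  have contk: "continuous_on S (\<lambda>x. k (h x))" if "continuous_on S h" for h and S :: "'a::t2_space set"
    unfolding k_def using nz by (intro continuous_intros that) auto
  have contI: "continuous_on {0..1} I"
    unfolding I_def
    by (intro integral_continuous_on_param) (auto simp: case_prod_unfold intro!: continuous_intros cont contk)
  have le: "2 * pi * cmod (poly F (of_real \<rho> * w)) powr p \<le> I \<rho>" if \<rho>: "\<rho> \<in> {0<..<1}" for \<rho>
  proof -
    define H where "H = (\<lambda>\<zeta>. exp (of_real p * g (of_real \<rho> * \<zeta>)))"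
    have mapsto: "of_real \<rho> * \<zeta> \<in> ball 0 1" if "cmod \<zeta> < 1 / \<rho>" for \<zeta> :: complex
      using that \<rho> by (simp add: norm_mult field_simps)
    have 1: "H holomorphic_on ball 0 (1 / \<rho>)"
      unfolding H_def
      by (intro holomorphic_intros holomorphic_on_compose_gen[OF _ g(1), unfolded o_def]) (use mapsto in auto)
    have absH: "cmod (H \<zeta>) = cmod (G (of_real \<rho> * \<zeta>)) powr p" if "cmod \<zeta> < 1 / \<rho>" for \<zeta>
      unfolding H_def g(2)[OF mapsto[OF that]] by (simp add: exp_powr_real mult.commute)
    have int: "((\<lambda>t. H (cis t) * of_real (k t)) has_integral 2 * of_real pi * H w) {- pi..pi}"
      unfolding k_def by (rule poisson_formula[OF 1 _ w]) (use \<rho> in auto)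
    have r1: "1 < 1 / \<rho>" using \<rho> by auto
    have "cmod w < 1 / \<rho>" using w r1 by linarith
    then have "2 * pi * cmod (G (of_real \<rho> * w)) powr p = cmod (2 * of_real pi * H w)"
      by (simp add: absH norm_mult)
    also have "\<dots> = cmod (integral (cbox (- pi) pi) (\<lambda>t. H (cis t) * of_real (k t)))"
      using int by (simp add: integral_unique)
    also have "\<dots> \<le> I \<rho>"
      unfolding I_def
    proof (rule integral_norm_bound_integral)
      show "(\<lambda>t. H (cis t) * of_real (k t)) integrable_on cbox (- pi) pi"
        using int by (auto simp: integrable_on_def)
      show "(\<lambda>t. cmod (G (of_real \<rho> * cis t)) powr p * k t) integrable_on cbox (- pi) pi"
        by (intro integrable_continuous continuous_intros cont contk)
      show "cmod (H (cis t) * of_real (k t)) \<le> cmod (G (of_real \<rho> * cis t)) powr p * k t" for t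
        using absH[of "cis t"] r1 k0[of t] by (simp add: norm_mult)
    qed
    finally have "2 * pi * cmod (G (of_real \<rho> * w)) powr p \<le> I \<rho>" .
    moreover have "cmod (poly F (of_real \<rho> * w)) powr p \<le> cmod (G (of_real \<rho> * w)) powr p"
      using mapsto[of w] \<open>cmod w < 1 / \<rho>\<close> p by (intro powr_mono2 G(4)) auto
    ultimately show ?thesis
      by (meson mult_left_mono order_trans pi_ge_zero mult_nonneg_nonneg zero_le_numeral)
  qed
  have "2 * pi * cmod (poly F (of_real 1 * w)) powr p \<le> I 1"
  proof (rule tendsto_le)
    show "at (1::real) within {0<..<1} \<noteq> bot"
      by (simp add: trivial_limit_within islimpt_greaterThanLessThan2)
    show "(I \<longlongrightarrow> I 1) (at 1 within {0<..<1})"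
      using contI unfolding continuous_on_def by (force intro: tendsto_within_subset)
    have "continuous_on UNIV (\<lambda>\<rho>. 2 * pi * cmod (poly F (of_real \<rho> * w)) powr p)"
      using p by (intro continuous_intros continuous_on_powr') auto
    then show "((\<lambda>\<rho>. 2 * pi * cmod (poly F (of_real \<rho> * w)) powr p) \<longlongrightarrow>
        2 * pi * cmod (poly F (of_real 1 * w)) powr p) (at 1 within {0<..<1})"
      unfolding continuous_on_def by (blast intro: tendsto_within_subset)
    show "\<forall>\<^sub>F \<rho> in at 1 within {0<..<1}. 2 * pi * cmod (poly F (of_real \<rho> * w)) powr p \<le> I \<rho>"
      using le by (simp add: eventually_at_filter)
  qed
  also have "I 1 = integral {- pi..pi} (\<lambda>t. cmod (poly F (cis t)) powr p * k t)"
    unfolding I_def by (simp add: G(3))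
  finally show ?thesis unfolding k_def by simp
qed (use p in simp)

definition trig_sum :: "nat \<Rightarrow> (int \<Rightarrow> complex) \<Rightarrow> complex \<Rightarrow> complex" where
  "trig_sum n c z = (\<Sum>k = - int n..int n. c k * exp (\<i> * of_int k * z))"

lemma trig_sum_holomorphic [holomorphic_intros]:
  assumes "f holomorphic_on S" shows "(\<lambda>z. trig_sum n c (f z)) holomorphic_on S"
  unfolding trig_sum_def by (intro holomorphic_intros assms)

lemma continuous_on_trig_sum [continuous_intros]:
  assumes "continuous_on S f" shows "continuous_on S (\<lambda>z. trig_sum n c (f z))"
  unfolding trig_sum_def by (intro continuous_intros assms)

lemma trig_sum_cnj: "cnj (trig_sum n c z) = trig_sum n (\<lambda>k. cnj (c (- k))) (cnj z)"
  unfolding trig_sum_def cnj_sum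
  by (rule sum.reindex_bij_witness[of _ uminus uminus]) (auto simp: exp_cnj)

lemma trig_sum_conv_poly:
  obtains F where "\<And>z. poly F (exp (\<i> * z)) = exp (\<i> * of_nat n * z) * trig_sum n c z"
proof
  define F where "F = (\<Sum>j\<le>2 * n. monom (c (int j - int n)) j)"
  fix z
  have "poly F (exp (\<i> * z)) = (\<Sum>j\<le>2 * n. c (int j - int n) * exp (\<i> * z) ^ j)"
    unfolding F_def by (simp add: poly_sum poly_monom)
  also have "\<dots> = (\<Sum>k = - int n..int n. exp (\<i> * of_nat n * z) * (c k * exp (\<i> * of_int k * z)))"
    by (rule sum.reindex_bij_witness[of _ "\<lambda>k. nat (k + int n)" "\<lambda>j. int j - int n"])
       (auto simp: exp_of_nat_mult [symmetric] mult_exp_exp algebra_simps)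
  also have "\<dots> = exp (\<i> * of_nat n * z) * trig_sum n c z"
    unfolding trig_sum_def by (simp add: sum_distrib_left)
  finally show "poly F (exp (\<i> * z)) = exp (\<i> * of_nat n * z) * trig_sum n c z" .
qed

text \<open>
  In the upper half-plane \<open>w = exp (i z)\<close> lies in the unit disc, and \<open>|T(z)| = exp (n b) |F(w)|\<close> for the
  polynomial \<open>F\<close> of the previous lemma.
\<close>
lemma trig_sum_powr_le_upper:
  assumes p: "0 < p" and b: "0 < b"
  shows "2 * pi * cmod (trig_sum n c (Complex x b)) powr p \<le> exp (p * (real n * b)) *
    integral {- pi..pi} (\<lambda>t. cmod (trig_sum n c (of_real t)) powr p * poisson_kernel b (t - x))"
proof -
  obtain F where F: "\<And>z. poly F (exp (\<i> * z)) = exp (\<i> * of_nat n * z) * trig_sum n c z"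
    using trig_sum_conv_poly by blast
  define w where "w = of_real (exp (- b)) * cis x"
  have w: "w = exp (\<i> * Complex x b)"
    unfolding w_def cis_conv_exp exp_of_real [symmetric] mult_exp_exp
    by (simp add: Complex_eq algebra_simps)
  have w1: "cmod w < 1" unfolding w_def using b by (simp add: norm_mult)
  have circ: "cmod (poly F (cis t)) = cmod (trig_sum n c (of_real t))" for t
    unfolding cis_conv_exp F by (simp add: norm_mult)
  have "cmod (poly F w) = exp (- (real n * b)) * cmod (trig_sum n c (Complex x b))"
    unfolding w F by (simp add: norm_mult)
  then have "cmod (trig_sum n c (Complex x b)) = exp (real n * b) * cmod (poly F w)"
    by (simp add: exp_minus field_simps)
  then have "cmod (trig_sum n c (Complex x b)) powr p = exp (p * (real n * b)) * cmod (poly F w) powr p"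
    by (simp add: powr_mult exp_powr_real mult_ac)
  then have "2 * pi * cmod (trig_sum n c (Complex x b)) powr p
      = exp (p * (real n * b)) * (2 * pi * cmod (poly F w) powr p)" by simp
  also have "\<dots> \<le> exp (p * (real n * b)) *
    integral {- pi..pi} (\<lambda>t. cmod (trig_sum n c (of_real t)) powr p * poisson_kernel b (t - x))"
    using poly_powr_le_poisson[OF p w1, of F]
    by (intro mult_left_mono) (simp_all add: circ poisson_kernel_disc[OF b w_def])
  finally show ?thesis .
qed

lemma trig_sum_powr_le:
  assumes p: "0 < p" and b: "b \<noteq> 0"
  shows "2 * pi * cmod (trig_sum n c (Complex x b)) powr p \<le> exp (p * (real n * \<bar>b\<bar>)) *
    integral {- pi..pi} (\<lambda>t. cmod (trig_sum n c (of_real t)) powr p * poisson_kernel \<bar>b\<bar> (t - x))"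
proof (cases "0 < b")
  case True
  then show ?thesis using trig_sum_powr_le_upper[OF p True] by simp
next
  case False
  define c' where "c' = (\<lambda>k. cnj (c (- k)))"
  have eq: "cmod (trig_sum n c' z) = cmod (trig_sum n c (cnj z))" for z
    using trig_sum_cnj[of n c "cnj z"] unfolding c'_def by (metis complex_cnj_cnj complex_mod_cnj)
  have "cnj (Complex x (- b)) = Complex x b" by (simp add: complex_eq_iff)
  with False b trig_sum_powr_le_upper[OF p, of "- b" n c' x] show ?thesis
    by (simp add: eq)
qed

section \<open>Estimates for Cauchy's formula\<close>

text \<open>
  Laplace's method, with the Poisson kernel in place of a Gaussian: \<open>exp (- \<kappa> (1 - cos \<theta>))\<close> is at most
  \<open>1 / (1 + \<kappa> (1 - cos \<theta>))\<close>, which is a multiple of the kernel of height \<open>b\<close> with \<open>cosh b = 1 + 1/\<kappa>\<close>, and the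
  integral of the kernel is known. The two peaks of \<open>|sin t|\<close> are treated separately.
\<close>
lemma integral_exp_abs_sin_le:
  assumes \<kappa>: "0 < \<kappa>"
  shows "integral {- pi..pi} (\<lambda>t. exp (\<kappa> * \<bar>sin t\<bar>)) \<le> 4 * pi * exp \<kappa> / sqrt (2 * \<kappa>)"
proof -
  define b where "b = arcosh (1 + 1 / \<kappa>)"
  have cb: "cosh b = 1 + 1 / \<kappa>" unfolding b_def using \<kappa> by simp
  have b0: "0 < b" unfolding b_def using \<kappa> by simp
  have sb: "sqrt (2 / \<kappa>) \<le> sinh b"
    unfolding b_def using \<kappa> by (subst sinh_arcosh_real) (auto simp: power2_sum)
  have sb0: "0 < sinh b" using b0 by simp
  define A where "A = exp \<kappa> / (\<kappa> * sinh b)"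
  have A0: "0 < A" unfolding A_def using \<kappa> sb0 by simp
  have one: "exp (\<kappa> * cos \<theta>) \<le> A * poisson_kernel b \<theta>" for \<theta>
  proof -
    have pos: "0 < cosh b - cos \<theta>" by (rule poisson_kernel_denom_pos[OF b0])
    have "exp (\<kappa> * cos \<theta>) = exp \<kappa> / exp (\<kappa> * (1 - cos \<theta>))"
      by (simp add: exp_diff [symmetric] algebra_simps)
    also have "\<dots> \<le> exp \<kappa> / (1 + \<kappa> * (1 - cos \<theta>))"
      using \<kappa> by (intro divide_left_mono exp_ge_add_one_self mult_pos_pos add_pos_nonneg mult_nonneg_nonneg) auto
    also have "1 + \<kappa> * (1 - cos \<theta>) = \<kappa> * (cosh b - cos \<theta>)"
      unfolding cb using \<kappa> by (simp add: field_simps)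
    also have "exp \<kappa> / (\<kappa> * (cosh b - cos \<theta>)) = A * poisson_kernel b \<theta>"
      unfolding A_def poisson_kernel_def using \<kappa> sb0 pos by (simp add: field_simps)
    finally show ?thesis .
  qed
  have bound: "exp (\<kappa> * \<bar>sin t\<bar>) \<le> A * (poisson_kernel b (t - pi / 2) + poisson_kernel b (t - (- (pi / 2))))" for t
  proof -
    have c1: "cos (t - pi / 2) = sin t" and c2: "cos (t - (- (pi / 2))) = - sin t"
      by (simp_all add: cos_add cos_diff)
    have "exp (\<kappa> * \<bar>sin t\<bar>) \<le> exp (\<kappa> * sin t) + exp (\<kappa> * - sin t)"
      by (simp add: abs_if)
    with one[of "t - pi / 2"] one[of "t - (- (pi / 2))"] show ?thesis
      unfolding c1 c2 by (simp add: distrib_left)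
  qed
  have "integral {- pi..pi} (\<lambda>t. exp (\<kappa> * \<bar>sin t\<bar>)) \<le> A * (2 * pi + 2 * pi)"
  proof (rule has_integral_le[OF integrable_integral])
    show "(\<lambda>t. exp (\<kappa> * \<bar>sin t\<bar>)) integrable_on {- pi..pi}"
      by (intro integrable_continuous_real continuous_intros)
    show "((\<lambda>t. A * (poisson_kernel b (t - pi / 2) + poisson_kernel b (t - (- (pi / 2)))))
        has_integral A * (2 * pi + 2 * pi)) {- pi..pi}"
      by (intro has_integral_mult_right has_integral_add poisson_kernel_integral b0)
  qed (rule bound)
  also have "\<dots> = 4 * pi * exp \<kappa> / (\<kappa> * sinh b)" unfolding A_def by simp
  also have "\<dots> \<le> 4 * pi * exp \<kappa> / sqrt (2 * \<kappa>)"
  proof -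
    have "sqrt (2 * \<kappa>) = \<kappa> * sqrt (2 / \<kappa>)"
      using \<kappa> real_sqrt_mult[of "\<kappa>\<^sup>2" "2 / \<kappa>"] by (simp add: power2_eq_square mult.commute)
    also have "\<dots> \<le> \<kappa> * sinh b" using sb \<kappa> by simp
    finally show ?thesis using \<kappa> sb0 by (intro divide_left_mono) auto
  qed
  finally show ?thesis .
qed

lemma ln_one_plus_lower:
  assumes "0 \<le> (u::real)"
  shows "2 * u / (2 + u) \<le> ln (1 + u)"
proof -
  have "ln (1 + 0) - 2 * 0 / (2 + 0) \<le> ln (1 + u) - 2 * u / (2 + u)"
  proof (rule DERIV_nonneg_imp_nondecreasing[OF assms])
    fix x :: real assume x: "0 \<le> x"
    have "((\<lambda>u. ln (1 + u) - 2 * u / (2 + u)) has_real_derivative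
        1 / (1 + x) - (2 * (2 + x) - 2 * x) / ((2 + x) * (2 + x))) (at x)"
      using x by (auto intro!: derivative_eq_intros)
    also have "1 / (1 + x) - (2 * (2 + x) - 2 * x) / ((2 + x) * (2 + x)) = x\<^sup>2 / ((1 + x) * (2 + x)\<^sup>2)"
      using x by (simp add: divide_simps power2_eq_square) (simp add: algebra_simps)
    finally have "((\<lambda>u. ln (1 + u) - 2 * u / (2 + u)) has_real_derivative x\<^sup>2 / ((1 + x) * (2 + x)\<^sup>2)) (at x)" .
    moreover have "0 \<le> x\<^sup>2 / ((1 + x) * (2 + x)\<^sup>2)" using x by simp
    ultimately show "\<exists>y. ((\<lambda>u. ln (1 + u) - 2 * u / (2 + u)) has_real_derivative y) (at x) \<and> 0 \<le> y"
      by blast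
  qed
  then show ?thesis by simp
qed

text \<open>
  The upper half of Stirling's formula: the quotient of the left-hand side by the right-hand side
  decreases with \<open>s\<close>, because \<open>(s + 1/2) ln (1 + 1/s) \<ge> 1\<close>, and it equals \<open>1\<close> at \<open>s = 1\<close>.
\<close>
lemma fact_exp_le:
  assumes "1 \<le> s"
  shows "fact s * exp (real s) \<le> exp 1 * real s ^ s * sqrt (real s)"
  using assms
proof (induction s rule: dec_induct)
  case (step s)
  have s: "0 < real s" using step by simp
  define u where "u = 1 / real s"
  have u: "0 < u" unfolding u_def using s by simp
  have "1 = (real s + 1 / 2) * (2 * u / (2 + u))"
    unfolding u_def using s by (simp add: field_simps)
  also have "\<dots> \<le> (real s + 1 / 2) * ln (1 + u)"
    using u s by (intro mult_left_mono ln_one_plus_lower) auto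
  finally have "exp 1 \<le> exp (real s * ln (1 + u) + ln (1 + u) / 2)"
    by (simp add: algebra_simps)
  also have "\<dots> = (1 + u) ^ s * sqrt (1 + u)"
    unfolding exp_add using u
    by (simp add: exp_of_nat_mult ln_sqrt [symmetric])
  finally have "exp 1 * (real s ^ s * sqrt (real s)) \<le> (1 + u) ^ s * sqrt (1 + u) * (real s ^ s * sqrt (real s))"
    using s by (intro mult_right_mono) auto
  also have "\<dots> = ((1 + u) * real s) ^ s * sqrt ((1 + u) * real s)"
    by (simp add: power_mult_distrib real_sqrt_mult)
  also have "(1 + u) * real s = real (Suc s)" unfolding u_def using s by (simp add: field_simps)
  finally have *: "exp 1 * (real s ^ s * sqrt (real s)) \<le> real (Suc s) ^ s * sqrt (real (Suc s))" .
  have "fact (Suc s) * exp (real (Suc s)) = real (Suc s) * exp 1 * (fact s * exp (real s))"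
    by (simp add: exp_add algebra_simps)
  also have "\<dots> \<le> real (Suc s) * exp 1 * (exp 1 * real s ^ s * sqrt (real s))"
    using step by (intro mult_left_mono) auto
  also have "\<dots> = real (Suc s) * exp 1 * (exp 1 * (real s ^ s * sqrt (real s)))" by simp
  also have "\<dots> \<le> real (Suc s) * exp 1 * (real (Suc s) ^ s * sqrt (real (Suc s)))"
    by (intro mult_left_mono *) auto
  finally show ?case by (simp add: mult_ac)
qed simp

lemma power_le_fact_mult_exp:
  assumes "0 \<le> (x::real)" shows "x ^ m \<le> fact m * exp x"
proof -
  have "(\<Sum>n\<in>{m}. x ^ n /\<^sub>R fact n) \<le> (\<Sum>n. x ^ n /\<^sub>R fact n)"
    using assms sums_summable[OF exp_converges[of x]] by (intro sum_le_suminf) auto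
  also have "\<dots> = exp x" by (rule sums_unique[OF exp_converges, symmetric])
  finally show ?thesis by (simp add: field_simps)
qed

lemma abs_sin_nat_mult_le: "\<bar>sin (real n * x)\<bar> \<le> real n * \<bar>sin x\<bar>"
proof (induction n)
  case (Suc n)
  have "real (Suc n) * x = real n * x + x" by (simp add: algebra_simps)
  then have "\<bar>sin (real (Suc n) * x)\<bar> = \<bar>sin (real n * x) * cos x + cos (real n * x) * sin x\<bar>"
    by (simp only: sin_add)
  also have "\<dots> \<le> \<bar>sin (real n * x)\<bar> * \<bar>cos x\<bar> + \<bar>cos (real n * x)\<bar> * \<bar>sin x\<bar>"
    by (metis abs_mult abs_triangle_ineq)
  also have "\<dots> \<le> \<bar>sin (real n * x)\<bar> * 1 + 1 * \<bar>sin x\<bar>"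
    by (intro add_mono mult_mono) auto
  finally show ?case using Suc by (simp add: algebra_simps)
qed simp

lemma one_minus_cis_power_le: "cmod (1 - cis t ^ (2 * s)) \<le> 2 * real s * \<bar>sin t\<bar>"
proof -
  have "cis t ^ (2 * s) = exp (\<i> * of_real (real (2 * s) * t))"
    by (simp only: Complex.DeMoivre flip: cis_conv_exp)
  then have "cmod (1 - cis t ^ (2 * s)) = 2 * \<bar>sin (real s * t)\<bar>"
    using dist_exp_i_1[of "real (2 * s) * t"] by (simp add: norm_minus_commute)
  also have "\<dots> \<le> 2 * (real s * \<bar>sin t\<bar>)" using abs_sin_nat_mult_le by simp
  finally show ?thesis by simp
qed

text \<open>
  Cauchy's formula with the weight \<open>h(u)\<^sup>m\<close>, where \<open>h(u) = 1 - ((u - z)/R)\<^sup>2\<^sup>s\<close>. Since \<open>h\<^sup>m - 1\<close> vanishes at \<open>z\<close> to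
  order \<open>2 s \<ge> s + 1\<close>, the weight does not change the value of the integral. The point of the circle
  is \<open>z - R cis t\<close> and not \<open>z + R cis t\<close> because the parameter interval \<open>[0, 2\<pi>]\<close> has been moved to \<open>[-\<pi>, \<pi>]\<close>
  by half a turn.
\<close>
lemma higher_deriv_cauchy_weighted:
  assumes f: "f holomorphic_on UNIV" and R: "0 < R" and s: "1 \<le> s"
  shows "cmod ((deriv ^^ s) f z) \<le> fact s / (2 * pi * R ^ s) *
    integral {- pi..pi} (\<lambda>t. cmod (f (z - of_real R * cis t)) * cmod (1 - cis t ^ (2 * s)) ^ m)"
proof -
  define h where "h = (\<lambda>u. 1 - ((u - z) / of_real R) ^ (2 * s))"
  define D where "D = (deriv ^^ s) f z"
  define Q where "Q = (\<lambda>u. - f u * (u - z) ^ (s - 1) / of_real R ^ (2 * s) * (\<Sum>j<m. h u ^ j))"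
  have "((\<lambda>u. f u / (u - z) ^ Suc s) has_contour_integral ((2 * pi * \<i>) / fact s * D)) (circlepath z R)"
    unfolding D_def
    by (rule Cauchy_has_contour_integral_higher_derivative_circlepath)
       (use R f in \<open>auto intro: holomorphic_on_imp_continuous_on holomorphic_on_subset\<close>)
  moreover have "(Q has_contour_integral 0) (circlepath z R)"
  proof (rule Cauchy_theorem_convex_simple)
    show "Q holomorphic_on UNIV"
      unfolding Q_def h_def using R by (intro holomorphic_intros f) auto
  qed auto
  ultimately have "((\<lambda>u. f u / (u - z) ^ Suc s + Q u) has_contour_integral ((2 * pi * \<i>) / fact s * D + 0)) (circlepath z R)"
    by (rule has_contour_integral_add)
  then have "((\<lambda>u. f u / (u - z) ^ Suc s + Q u) has_contour_integral ((2 * pi * \<i>) / fact s * D)) (circlepath z R)"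
    by simp
  then have "((\<lambda>u. f u * h u ^ m / (u - z) ^ Suc s) has_contour_integral ((2 * pi * \<i>) / fact s * D)) (circlepath z R)"
  proof (rule has_contour_integral_eq)
    fix u assume "u \<in> path_image (circlepath z R)"
    then have nz: "u - z \<noteq> 0" using R by auto
    have "h u ^ m - 1 = (h u - 1) * (\<Sum>j<m. h u ^ j)"
      by (rule power_diff_1_eq)
    also have "h u - 1 = - ((u - z) ^ (s - 1) * (u - z) ^ Suc s) / of_real R ^ (2 * s)"
      unfolding h_def power_add [symmetric] using s by (simp add: power_divide mult_2)
    finally have "h u ^ m - 1 = - ((u - z) ^ (s - 1) * (u - z) ^ Suc s) / of_real R ^ (2 * s) * (\<Sum>j<m. h u ^ j)" .
    moreover have "w = 1 - P / A * S" if "w - 1 = - P / A * S" for w P A S :: complex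
      using that by (simp add: algebra_simps)
    ultimately have "h u ^ m = 1 - ((u - z) ^ (s - 1) * (u - z) ^ Suc s) / of_real R ^ (2 * s) * (\<Sum>j<m. h u ^ j)"
      by blast
    moreover have "F / Y + - F * X / A * S = F * (1 - X * Y / A * S) / Y" if "Y \<noteq> 0" "A \<noteq> 0" for F X Y A S :: complex
      using that by (simp add: field_simps)
    ultimately show "f u / (u - z) ^ Suc s + Q u = f u * h u ^ m / (u - z) ^ Suc s"
      unfolding Q_def using nz R by (metis of_real_eq_0_iff power_not_zero less_irrefl)
  qed
  then have "((\<lambda>t. f (z + of_real R * cis t) * h (z + of_real R * cis t) ^ m / (of_real R * cis t) ^ Suc s * of_real R * \<i> * cis t)
      has_integral ((2 * pi * \<i>) / fact s * D)) {0..2 * pi}"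
    unfolding circlepath_def by (subst (asm) has_contour_integral_part_circlepath_iff) simp_all
  then have "((\<lambda>t. (- \<i>) * (f (z + of_real R * cis t) * h (z + of_real R * cis t) ^ m / (of_real R * cis t) ^ Suc s * of_real R * \<i> * cis t))
      has_integral (- \<i>) * ((2 * pi * \<i>) / fact s * D)) {0..2 * pi}"
    by (rule has_integral_mult_right)
  then have "((\<lambda>t. f (z + of_real R * cis t) * (h (z + of_real R * cis t) ^ m / (of_real R * cis t) ^ s))
      has_integral ((2 * pi) / fact s * D)) {0..2 * pi}"
    using R by (simp add: mult_ac)
  from has_integral_shift_pi[OF this]
  have "((\<lambda>t. f (z - of_real R * cis t) * (h (z - of_real R * cis t) ^ m / (- of_real R * cis t) ^ s))
      has_integral ((2 * pi) / fact s * D)) {- pi..pi}" (is "(?g has_integral _) _")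
    by (simp add: cis_mult [symmetric])
  then have g: "?g integrable_on {- pi..pi}" "integral {- pi..pi} ?g = (2 * pi) / fact s * D"
    by (auto simp: has_integral_iff)
  have h: "h (z - of_real R * cis t) = 1 - cis t ^ (2 * s)" for t
    unfolding h_def using R by (simp add: power_mult)
  have "(2 * pi) / fact s * cmod D = norm (integral {- pi..pi} ?g)"
    unfolding g(2) by (simp add: norm_mult norm_divide)
  also have "\<dots> \<le> integral {- pi..pi} (\<lambda>t. cmod (f (z - of_real R * cis t)) * cmod (1 - cis t ^ (2 * s)) ^ m / R ^ s)"
  proof (rule integral_norm_bound_integral[OF g(1)])
    show "(\<lambda>t. cmod (f (z - of_real R * cis t)) * cmod (1 - cis t ^ (2 * s)) ^ m / R ^ s) integrable_on {- pi..pi}"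
      using R by (intro integrable_continuous_real continuous_intros
          continuous_on_compose2[OF holomorphic_on_imp_continuous_on[OF f]]) auto
    show "norm (?g t) \<le> cmod (f (z - of_real R * cis t)) * cmod (1 - cis t ^ (2 * s)) ^ m / R ^ s" for t
      unfolding h using R by (simp add: norm_mult norm_divide norm_power)
  qed
  also have "\<dots> = integral {- pi..pi} (\<lambda>t. cmod (f (z - of_real R * cis t)) * cmod (1 - cis t ^ (2 * s)) ^ m) / R ^ s"
    by simp
  finally show ?thesis unfolding D_def using R by (simp add: field_simps)
qed

text \<open>
  Here \<open>\<sigma>\<close> stands for \<open>|sin t|\<close> and \<open>a\<close> for \<open>|h|\<close> at the point of angle \<open>t\<close>. Away from the real axis, the
  Harnack loss \<open>3/\<sigma>\<close> is bounded. Close to it, \<open>a\<^sup>m\<close> absorbs the loss at the price of \<open>(2 s)\<^sup>m\<close>, and half of the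
  exponential gap \<open>exp (s (1 - \<sigma>))\<close> pays for this. The other half is what remains on the right-hand side.
\<close>
lemma circle_integrand_bound:
  fixes \<sigma> r a :: real
  assumes r: "0 < r" and m: "1 / r \<le> real m" and \<sigma>: "0 < \<sigma>" "\<sigma> \<le> 1"
    and a: "0 \<le> a" "a \<le> 2" "a \<le> 2 * real s * \<sigma>"
  shows "a ^ m * (3 / \<sigma>) powr (1 / r) * exp (real s * \<sigma>)
    \<le> 6 powr (1 / r) * 8 ^ m * fact m * (exp (real s / 2) * exp (real s / 2 * \<sigma>))"
proof (cases "1 / 2 \<le> \<sigma>")
  case True
  have "a ^ m \<le> 2 ^ m" using a by (intro power_mono) auto
  also have "(2::real) ^ m \<le> 8 ^ m * fact m"
    using mult_mono[of "(2::real) ^ m" "8 ^ m" 1 "fact m"] by (simp add: power_mono)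
  finally have 1: "a ^ m \<le> 8 ^ m * fact m" .
  have 2: "(3 / \<sigma>) powr (1 / r) \<le> 6 powr (1 / r)"
    using True r by (intro powr_mono2) (auto simp: field_simps)
  have 3: "exp (real s * \<sigma>) \<le> exp (real s / 2) * exp (real s / 2 * \<sigma>)"
    using mult_left_mono[OF \<sigma>(2), of "real s / 2"] by (simp add: mult_exp_exp)
  have "a ^ m * (3 / \<sigma>) powr (1 / r) * exp (real s * \<sigma>)
    \<le> (8 ^ m * fact m) * 6 powr (1 / r) * (exp (real s / 2) * exp (real s / 2 * \<sigma>))"
    using a \<sigma> by (intro mult_mono 1 2 3) auto
  then show ?thesis by (simp add: mult_ac)
next
  case False
  have "a ^ m * (3 / \<sigma>) powr (1 / r) \<le> (2 * real s * \<sigma>) ^ m * (3 / \<sigma>) powr (1 / r)"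
    using a by (intro mult_right_mono power_mono) auto
  also have "\<dots> = (2 * real s) ^ m * 3 powr (1 / r) * (\<sigma> powr real m / \<sigma> powr (1 / r))"
    using \<sigma> by (simp add: power_mult_distrib powr_divide powr_realpow)
  also have "\<dots> \<le> (8 ^ m * (fact m * exp (real s / 4))) * 6 powr (1 / r) * 1"
  proof (intro mult_mono)
    have "(2 * real s) ^ m = (8 * (real s / 4)) ^ m" by simp
    also have "\<dots> = 8 ^ m * (real s / 4) ^ m" by (rule power_mult_distrib)
    also have "\<dots> \<le> 8 ^ m * (fact m * exp (real s / 4))"
      by (intro mult_left_mono power_le_fact_mult_exp) auto
    finally show "(2 * real s) ^ m \<le> 8 ^ m * (fact m * exp (real s / 4))" .
    show "(3::real) powr (1 / r) \<le> 6 powr (1 / r)"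
      using r by (intro powr_mono2) auto
    show "\<sigma> powr real m / \<sigma> powr (1 / r) \<le> 1"
      using \<sigma> m powr_mono'[of "1 / r" "real m" \<sigma>] by simp
  qed auto
  finally have 1: "a ^ m * (3 / \<sigma>) powr (1 / r) \<le> 8 ^ m * (fact m * exp (real s / 4)) * 6 powr (1 / r) * 1" .
  have "real s / 4 + real s * \<sigma> \<le> real s / 2 + real s / 2 * \<sigma>"
    using mult_left_mono[of \<sigma> "1 / 2" "real s / 2"] False by (simp add: algebra_simps)
  then have 2: "exp (real s / 4) * exp (real s * \<sigma>) \<le> exp (real s / 2) * exp (real s / 2 * \<sigma>)"
    by (simp add: mult_exp_exp)
  have "a ^ m * (3 / \<sigma>) powr (1 / r) * exp (real s * \<sigma>)
    \<le> 8 ^ m * (fact m * exp (real s / 4)) * 6 powr (1 / r) * 1 * exp (real s * \<sigma>)"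
    by (intro mult_right_mono 1) auto
  also have "\<dots> = 6 powr (1 / r) * 8 ^ m * fact m * (exp (real s / 4) * exp (real s * \<sigma>))"
    by simp
  also have "\<dots> \<le> 6 powr (1 / r) * 8 ^ m * fact m * (exp (real s / 2) * exp (real s / 2 * \<sigma>))"
    by (intro mult_left_mono 2) auto
  finally show ?thesis .
qed

section \<open>Pointwise domination of the derivatives\<close>

definition poisson_mean :: "real \<Rightarrow> (real \<Rightarrow> real) \<Rightarrow> real \<Rightarrow> real" where
  "poisson_mean R u x = integral {- pi..pi} (\<lambda>t. u t * poisson_kernel R (t - x)) / (2 * pi)"

text \<open>
  The point of angle \<open>t\<close> on the circle of radius \<open>R = s / n\<close> has height \<open>R |sin t|\<close> up to sign, so that the
  growth factor is \<open>exp (s |sin t|)\<close>. Harnack's inequality moves the kernel to height \<open>R\<close> above the centre.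
\<close>
lemma trig_sum_le_poisson_mean:
  assumes r: "0 < r" and n: "1 \<le> n" and s: "1 \<le> s" and t: "sin t \<noteq> 0"
  defines "R \<equiv> real s / real n"
  shows "cmod (trig_sum n c (of_real x - of_real R * cis t)) \<le>
    exp (real s * \<bar>sin t\<bar>) * (3 / \<bar>sin t\<bar>) powr (1 / r)
      * poisson_mean R (\<lambda>t. cmod (trig_sum n c (of_real t)) powr r) x powr (1 / r)"
proof -
  define u where "u = (\<lambda>t. cmod (trig_sum n c (of_real t)) powr r)"
  define \<sigma> where "\<sigma> = \<bar>sin t\<bar>"
  have \<sigma>: "0 < \<sigma>" "\<sigma> \<le> 1" unfolding \<sigma>_def using t by auto
  have R: "0 < R" unfolding R_def using n s by simp
  have contu: "continuous_on S u" for S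
    unfolding u_def using r by (intro continuous_on_powr' continuous_intros) auto
  define a where "a = - (R * cos t)"
  define b where "b = - (R * sin t)"
  have absb: "\<bar>b\<bar> = R * \<sigma>" unfolding b_def \<sigma>_def using R by (simp add: abs_mult)
  have z: "of_real x - of_real R * cis t = Complex (x + a) b"
    unfolding a_def b_def by (simp add: complex_eq_iff)
  have b0: "0 < \<bar>b\<bar>" "b \<noteq> 0" "\<bar>b\<bar> \<le> R"
    using R \<sigma> t mult_left_le[of \<sigma> R] absb by (auto simp: b_def)
  have aR: "\<bar>a\<bar> \<le> R" unfolding a_def using R by (simp add: abs_mult mult_left_le)
  have u0: "0 \<le> u y" for y unfolding u_def by simp
  have "2 * pi * cmod (trig_sum n c (Complex (x + a) b)) powr r \<le> exp (r * (real n * \<bar>b\<bar>)) *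
      integral {- pi..pi} (\<lambda>t. u t * poisson_kernel \<bar>b\<bar> (t - (x + a)))"
    unfolding u_def by (rule trig_sum_powr_le[OF r b0(2)])
  also have "real n * \<bar>b\<bar> = real s * \<sigma>" unfolding absb R_def using n by simp
  also have "integral {- pi..pi} (\<lambda>t. u t * poisson_kernel \<bar>b\<bar> (t - (x + a)))
      \<le> integral {- pi..pi} (\<lambda>t. 3 / \<sigma> * (u t * poisson_kernel R (t - x)))"
  proof (rule integral_le)
    fix y
    have "poisson_kernel \<bar>b\<bar> (y - (x + a)) \<le> 3 * (R / \<bar>b\<bar>) * poisson_kernel R (y - x)"
      using poisson_kernel_harnack[OF b0(1,3) aR, of "y - x"] by (simp add: algebra_simps)
    also have "R / \<bar>b\<bar> = 1 / \<sigma>" unfolding absb using R by simp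
    finally have "poisson_kernel \<bar>b\<bar> (y - (x + a)) \<le> 3 * (1 / \<sigma>) * poisson_kernel R (y - x)" .
    from mult_left_mono[OF this u0[of y]]
    show "u y * poisson_kernel \<bar>b\<bar> (y - (x + a)) \<le> 3 / \<sigma> * (u y * poisson_kernel R (y - x))"
      by (simp add: mult_ac)
  qed (intro integrable_continuous_real continuous_intros contu continuous_on_poisson_kernel b0 R)+
  also have "\<dots> = 3 / \<sigma> * (2 * pi * poisson_mean R u x)"
    unfolding poisson_mean_def by simp
  finally have "2 * pi * cmod (trig_sum n c (Complex (x + a) b)) powr r
      \<le> 2 * pi * (exp (r * (real s * \<sigma>)) * (3 / \<sigma>) * poisson_mean R u x)"
    by (simp add: mult_ac)
  then have "cmod (trig_sum n c (Complex (x + a) b)) powr r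
      \<le> exp (r * (real s * \<sigma>)) * (3 / \<sigma>) * poisson_mean R u x"
    by (rule mult_left_le_imp_le) simp
  then have "(cmod (trig_sum n c (Complex (x + a) b)) powr r) powr (1 / r)
      \<le> (exp (r * (real s * \<sigma>)) * (3 / \<sigma>) * poisson_mean R u x) powr (1 / r)"
    using r by (intro powr_mono2) auto
  also have "(cmod (trig_sum n c (Complex (x + a) b)) powr r) powr (1 / r) = cmod (trig_sum n c (Complex (x + a) b))"
    using r by (simp add: powr_powr)
  also have "(exp (r * (real s * \<sigma>)) * (3 / \<sigma>) * poisson_mean R u x) powr (1 / r)
     = exp (real s * \<sigma>) * (3 / \<sigma>) powr (1 / r) * poisson_mean R u x powr (1 / r)"
    unfolding powr_mult exp_powr_real using r by simp
  finally show ?thesis unfolding z u_def \<sigma>_def .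
qed

text \<open>
  Integration of this estimate gives Bernstein's inequality with a constant independent of \<open>s\<close>, even
  for \<open>r < 1\<close>, and the bound for the kernel gives an inequality of Nikolskii type.
\<close>
lemma higher_deriv_le_poisson_mean:
  assumes r: "0 < r"
  obtains K where "0 < K"
    "\<And>n s c x. 1 \<le> n \<Longrightarrow> 1 \<le> s \<Longrightarrow> cmod ((deriv ^^ s) (trig_sum n c) (of_real x)) \<le>
       K * real n ^ s *
       poisson_mean (real s / real n) (\<lambda>t. cmod (trig_sum n c (of_real t)) powr r) x powr (1 / r)"
proof
  \<comment> \<open>the weight then vanishes at the real points to an order that makes up for the Harnack loss\<close>
  define m where "m = nat \<lceil>1 / r\<rceil>"
  have m: "1 / r \<le> real m" unfolding m_def by linarith
  have m0: "0 < m" using m r by (metis gr0I less_le_not_le of_nat_0 zero_less_divide_1_iff)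
  define K where "K = 6 powr (1 / r) * 8 ^ m * (fact m :: real)"
  have K: "0 < K" unfolding K_def by simp
  then show "0 < 2 * exp 1 * K" by simp
  fix n s :: nat and c x
  assume n: "1 \<le> n" and s: "1 \<le> s"
  define R where "R = real s / real n"
  have R: "0 < R" unfolding R_def using n s by simp
  define J where "J = poisson_mean R (\<lambda>t. cmod (trig_sum n c (of_real t)) powr r) x powr (1 / r)"
  have J: "0 \<le> J" unfolding J_def by simp
  have pointwise: "cmod (trig_sum n c (of_real x - of_real R * cis t)) * cmod (1 - cis t ^ (2 * s)) ^ m
      \<le> K * exp (real s / 2) * J * exp (real s / 2 * \<bar>sin t\<bar>)" for t
  \<comment> \<open>at the two real points there is no Poisson bound, but the weight is \<open>0\<close>\<close>
  proof (cases "sin t = 0")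
    case True
    then have "1 - cis t ^ (2 * s) = 0" using one_minus_cis_power_le[of t s] by simp
    then show ?thesis using m0 less_imp_le[OF K] J by (simp add: power_0_left)
  next
    case False
    have le2: "cmod (1 - cis t ^ (2 * s)) \<le> 2"
      using norm_triangle_ineq4[of 1 "cis t ^ (2 * s)"] by (simp add: norm_power)
    have "cmod (trig_sum n c (of_real x - of_real R * cis t)) * cmod (1 - cis t ^ (2 * s)) ^ m
      \<le> (exp (real s * \<bar>sin t\<bar>) * (3 / \<bar>sin t\<bar>) powr (1 / r) * J) * cmod (1 - cis t ^ (2 * s)) ^ m"
      unfolding J_def R_def by (intro mult_right_mono trig_sum_le_poisson_mean r n s False) auto
    also have "\<dots> = (cmod (1 - cis t ^ (2 * s)) ^ m * (3 / \<bar>sin t\<bar>) powr (1 / r) * exp (real s * \<bar>sin t\<bar>)) * J"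
      by simp
    also have "\<dots> \<le> (K * (exp (real s / 2) * exp (real s / 2 * \<bar>sin t\<bar>))) * J"
      unfolding K_def using False
      by (intro mult_right_mono circle_integrand_bound r m J le2 one_minus_cis_power_le) auto
    finally show ?thesis by (simp add: mult_ac)
  qed
  have "integral {- pi..pi} (\<lambda>t. cmod (trig_sum n c (of_real x - of_real R * cis t)) * cmod (1 - cis t ^ (2 * s)) ^ m)
      \<le> integral {- pi..pi} (\<lambda>t. K * exp (real s / 2) * J * exp (real s / 2 * \<bar>sin t\<bar>))"
    by (rule integral_le[OF _ _ pointwise]) (intro integrable_continuous_real continuous_intros)+
  also have "\<dots> = K * exp (real s / 2) * J * integral {- pi..pi} (\<lambda>t. exp (real s / 2 * \<bar>sin t\<bar>))"
    by simp
  also have "\<dots> \<le> K * exp (real s / 2) * J * (4 * pi * exp (real s / 2) / sqrt (2 * (real s / 2)))"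
    using K J s by (intro mult_left_mono integral_exp_abs_sin_le) auto
  also have "\<dots> = 4 * pi * K * J * (exp (real s) / sqrt (real s))"
    using exp_add[of "real s / 2" "real s / 2"] by simp
  finally have int: "integral {- pi..pi} (\<lambda>t. cmod (trig_sum n c (of_real x - of_real R * cis t)) * cmod (1 - cis t ^ (2 * s)) ^ m)
      \<le> 4 * pi * K * J * (exp (real s) / sqrt (real s))" .
  have "cmod ((deriv ^^ s) (trig_sum n c) (of_real x)) \<le> fact s / (2 * pi * R ^ s) *
    integral {- pi..pi} (\<lambda>t. cmod (trig_sum n c (of_real x - of_real R * cis t)) * cmod (1 - cis t ^ (2 * s)) ^ m)"
    by (intro higher_deriv_cauchy_weighted holomorphic_intros R s)
  also have "\<dots> \<le> fact s / (2 * pi * R ^ s) * (4 * pi * K * J * (exp (real s) / sqrt (real s)))"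
    using R by (intro mult_left_mono int) auto
  also have "\<dots> = 2 * K * J / (R ^ s * sqrt (real s)) * (fact s * exp (real s))"
    by simp
  also have "\<dots> \<le> 2 * K * J / (R ^ s * sqrt (real s)) * (exp 1 * real s ^ s * sqrt (real s))"
    using R K J by (intro mult_left_mono fact_exp_le s) auto
  also have "\<dots> = 2 * exp 1 * K * real n ^ s * J"
    unfolding R_def using n s by (simp add: power_divide)
  finally show "cmod ((deriv ^^ s) (trig_sum n c) (of_real x)) \<le> 2 * exp 1 * K * real n ^ s *
       poisson_mean (real s / real n) (\<lambda>t. cmod (trig_sum n c (of_real t)) powr r) x powr (1 / r)"
    unfolding J_def R_def .
qed

section \<open>Upper bound\<close>

lemma trig_sum_has_field_derivative:
  "(trig_sum n c has_field_derivative trig_sum n (\<lambda>k. c k * (\<i> * of_int k)) z) (at z)"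
  unfolding trig_sum_def by (auto intro!: derivative_eq_intros sum.cong simp: mult_ac)

lemma higher_deriv_trig_sum:
  "(deriv ^^ s) (trig_sum n c) = trig_sum n (\<lambda>k. c k * (\<i> * of_int k) ^ s)"
proof (induction s)
  case (Suc s)
  show ?case
    unfolding funpow.simps o_def Suc
    using DERIV_imp_deriv[OF trig_sum_has_field_derivative[of n "\<lambda>k. c k * (\<i> * of_int k) ^ s"]]
    by (simp add: fun_eq_iff mult_ac)
qed simp

lemma nth_deriv_trig_sum:
  "nth_deriv s (\<lambda>x. trig_sum n c (of_real x)) = (\<lambda>x. trig_sum n (\<lambda>k. c k * (\<i> * of_int k) ^ s) (of_real x))"
proof (induction s)
  case (Suc s)
  have "vector_derivative (\<lambda>x. trig_sum n c (of_real x)) (at x) = trig_sum n (\<lambda>k. c k * (\<i> * of_int k)) (of_real x)" for c x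
    by (rule vector_derivative_at has_vector_derivative_real_field trig_sum_has_field_derivative)+
  then show ?case
    using Suc unfolding nth_deriv_def by (simp add: mult_ac)
qed (simp add: nth_deriv_def)

lemma trig_polys_eq: "trig_polys n = {T. \<exists>c. T = (\<lambda>x. trig_sum n c (of_real x))}"
  unfolding trig_polys_def trig_sum_def ..

lemma per_norm_finite:
  assumes r: "0 < r" and f: "continuous_on UNIV f"
  shows "per_norm (ereal r) f = ereal ((integral {- pi..pi} (\<lambda>x. cmod (f x) powr r)) powr (1 / r))"
proof -
  have "continuous_on {- pi..pi} (\<lambda>x. cmod (f x) powr r)"
    using r by (intro continuous_on_powr' continuous_intros continuous_on_subset[OF f]) auto
  then have int: "integrable (lebesgue_on {- pi..pi}) (\<lambda>x. cmod (f x) powr r)"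
    by (rule continuous_imp_integrable_real)
  then have "integral\<^sup>L (lebesgue_on {- pi..pi}) (\<lambda>x. cmod (f x) powr r) = integral {- pi..pi} (\<lambda>x. cmod (f x) powr r)"
    by (rule lebesgue_integral_eq_integral) simp
  with int show ?thesis unfolding per_norm_def by simp
qed

lemma borel_measurable_cmod_lebesgue_on:
  assumes f: "continuous_on UNIV (f :: real \<Rightarrow> complex)"
  shows "(\<lambda>x. ereal (cmod (f x))) \<in> borel_measurable (lebesgue_on {- pi..pi})"
proof -
  have "(\<lambda>x. cmod (f x)) \<in> borel_measurable (lebesgue_on {- pi..pi})"
    by (intro continuous_imp_measurable_on_sets_lebesgue continuous_intros continuous_on_subset[OF f]) auto
  then show ?thesis by simp
qed

text \<open>
  Interpolation between \<open>J \<le> L\<close> and \<open>\<integral>J \<le> 1\<close>. For \<open>q = v\<close> finite, \<open>J\<close> to the power \<open>v/r\<close> is at most \<open>J\<close> times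
  \<open>L\<close> to the power \<open>v/r - 1\<close>, and the \<open>v\<close>-th root of the latter is \<open>L\<close> to the power \<open>1/r - 1/v\<close>.
\<close>
lemma per_norm_le:
  assumes r: "0 < r" and q: "ereal r < q" and f: "continuous_on UNIV f" and A: "0 \<le> A"
    and J: "continuous_on UNIV J" "\<And>x. 0 \<le> J x" "\<And>x. J x \<le> L" "integral {- pi..pi} J \<le> 1"
    and fJ: "\<And>x. cmod (f x) \<le> A * J x powr (1 / r)"
  shows "per_norm q f \<le> ereal (A * L powr real_of_ereal (1 / ereal r - 1 / q))"
proof -
  have L: "0 \<le> L" using J(2)[of 0] J(3)[of 0] by linarith
  show ?thesis
  proof (cases "q = \<infinity>")
    case True
    have "cmod (f x) \<le> A * L powr (1 / r)" for x
      using fJ[of x] A r by (elim order_trans) (intro mult_left_mono powr_mono2 J, auto)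
    then have "esssup (lebesgue_on {- pi..pi}) (\<lambda>x. ereal (cmod (f x))) \<le> ereal (A * L powr (1 / r))"
      by (intro esssup_I borel_measurable_cmod_lebesgue_on f) auto
    then show ?thesis unfolding per_norm_def using True r by (simp add: one_ereal_def)
  next
    case False
    then obtain v where v: "q = ereal v" "r < v" using q by (cases q) auto
    have v0: "0 < v" using v r by linarith
    have "integral {- pi..pi} (\<lambda>x. cmod (f x) powr v) \<le> integral {- pi..pi} (\<lambda>x. A powr v * L powr (v / r - 1) * J x)"
    proof (rule integral_le)
      show "(\<lambda>x. cmod (f x) powr v) integrable_on {- pi..pi}"
        using v0 by (intro integrable_continuous_real continuous_on_powr' continuous_intros continuous_on_subset[OF f]) auto
      show "(\<lambda>x. A powr v * L powr (v / r - 1) * J x) integrable_on {- pi..pi}"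
        by (intro integrable_continuous_real continuous_intros continuous_on_subset[OF J(1)]) auto
      fix x
      have "cmod (f x) powr v \<le> (A * J x powr (1 / r)) powr v"
        using v0 by (intro powr_mono2 fJ) auto
      also have "\<dots> = A powr v * (J x powr (v / r - 1) * J x)"
      proof (cases "J x = 0")
        case False
        then show ?thesis using A J(2)[of x]
          by (simp add: powr_mult powr_powr powr_diff)
      qed (use v0 in simp)
      also have "\<dots> \<le> A powr v * (L powr (v / r - 1) * J x)"
        using v r by (intro mult_left_mono mult_right_mono powr_mono2 J) (auto simp: field_simps)
      finally show "cmod (f x) powr v \<le> A powr v * L powr (v / r - 1) * J x" by (simp add: mult_ac)
    qed
    also have "\<dots> = A powr v * L powr (v / r - 1) * integral {- pi..pi} J" by simp
    also have "\<dots> \<le> A powr v * L powr (v / r - 1)"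
      using J(4) by (intro mult_left_le) auto
    finally have "integral {- pi..pi} (\<lambda>x. cmod (f x) powr v) \<le> A powr v * L powr (v / r - 1)" .
    then have "integral {- pi..pi} (\<lambda>x. cmod (f x) powr v) powr (1 / v) \<le> (A powr v * L powr (v / r - 1)) powr (1 / v)"
      using v0 by (intro powr_mono2 Henstock_Kurzweil_Integration.integral_nonneg integrable_continuous_real continuous_on_powr' continuous_intros continuous_on_subset[OF f]) auto
    also have "\<dots> = A * L powr (1 / r - 1 / v)"
      using A L v0 r by (simp add: powr_mult powr_powr field_simps)
    finally show ?thesis
      unfolding v per_norm_finite[OF v0 f] using r v0 by (simp add: one_ereal_def)
  qed
qed

lemma poisson_mean_continuous:
  assumes R: "0 < R" and u: "continuous_on UNIV u"
  shows "continuous_on UNIV (poisson_mean R u)"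
proof -
  have "continuous_on UNIV (\<lambda>x. integral (cbox (- pi) pi) (\<lambda>t. u t * poisson_kernel R (t - x)))"
    unfolding poisson_kernel_def using poisson_kernel_denom_pos[OF R]
    by (intro integral_continuous_on_param)
       (auto simp: case_prod_unfold less_imp_neq[THEN not_sym] intro!: continuous_intros continuous_on_compose2[OF u])
  then show ?thesis
    unfolding poisson_mean_def by (intro continuous_intros) auto
qed

lemma poisson_mean_le:
  assumes R: "0 < R" and u: "continuous_on UNIV u" "\<And>x. 0 \<le> u x"
  shows "0 \<le> poisson_mean R u x" "poisson_mean R u x \<le> (1 + 2 / R) * integral {- pi..pi} u"
proof -
  have int: "(\<lambda>t. u t * poisson_kernel R (t - x)) integrable_on {- pi..pi}"
    by (intro integrable_continuous_real continuous_intros continuous_on_poisson_kernel R continuous_on_subset[OF u(1)]) auto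
  have "0 \<le> integral {- pi..pi} (\<lambda>t. u t * poisson_kernel R (t - x))"
    using int u(2) poisson_kernel_pos[OF R] by (intro Henstock_Kurzweil_Integration.integral_nonneg mult_nonneg_nonneg) (auto simp: less_imp_le)
  then show "0 \<le> poisson_mean R u x" unfolding poisson_mean_def by simp
  have "integral {- pi..pi} (\<lambda>t. u t * poisson_kernel R (t - x)) \<le> integral {- pi..pi} (\<lambda>t. (1 + 2 / R) * u t)"
  proof (rule integral_le[OF int])
    show "(\<lambda>t. (1 + 2 / R) * u t) integrable_on {- pi..pi}"
      by (intro integrable_continuous_real continuous_intros continuous_on_subset[OF u(1)]) auto
    show "u t * poisson_kernel R (t - x) \<le> (1 + 2 / R) * u t" for t
      using mult_left_mono[OF poisson_kernel_le[OF R] u(2)[of t], of "t - x"] by (simp add: mult.commute)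
  qed
  also have "\<dots> = (1 + 2 / R) * integral {- pi..pi} u" by simp
  finally have le: "integral {- pi..pi} (\<lambda>t. u t * poisson_kernel R (t - x)) \<le> (1 + 2 / R) * integral {- pi..pi} u" .
  have "0 \<le> integral {- pi..pi} u"
    using u by (intro Henstock_Kurzweil_Integration.integral_nonneg integrable_continuous_real continuous_on_subset[OF u(1)]) auto
  then have "0 \<le> (1 + 2 / R) * integral {- pi..pi} u" using R by simp
  then have "1 * ((1 + 2 / R) * integral {- pi..pi} u) \<le> 2 * pi * ((1 + 2 / R) * integral {- pi..pi} u)"
    using pi_gt3 by (intro mult_right_mono) auto
  with le show "poisson_mean R u x \<le> (1 + 2 / R) * integral {- pi..pi} u"
    unfolding poisson_mean_def by (simp add: divide_le_eq mult.commute)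
qed

lemma integral_poisson_mean:
  assumes R: "0 < R" and u: "continuous_on UNIV u"
  shows "integral {- pi..pi} (poisson_mean R u) = integral {- pi..pi} u"
proof -
  have sym: "poisson_kernel R (t - x) = poisson_kernel R (x - t)" for t x
    unfolding poisson_kernel_def by (metis cos_minus minus_diff_eq)
  have "integral (cbox (- pi) pi) (\<lambda>x. integral (cbox (- pi) pi) (\<lambda>t. u t * poisson_kernel R (t - x)))
      = integral (cbox (- pi) pi) (\<lambda>t. integral (cbox (- pi) pi) (\<lambda>x. u t * poisson_kernel R (t - x)))"
    unfolding poisson_kernel_def using poisson_kernel_denom_pos[OF R]
    by (intro integral_swap_continuous)
       (auto simp: case_prod_unfold less_imp_neq[THEN not_sym] intro!: continuous_intros continuous_on_compose2[OF u])
  also have "\<dots> = integral (cbox (- pi) pi) (\<lambda>t. u t * (2 * pi))"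
  proof -
    have "integral {- pi..pi} (\<lambda>x. poisson_kernel R (t - x)) = 2 * pi" for t
      unfolding sym by (rule integral_unique[OF poisson_kernel_integral[OF R]])
    then show ?thesis by simp
  qed
  finally show ?thesis unfolding poisson_mean_def by simp
qed

lemma nikolskii_bernstein_upper:
  assumes r: "0 < r" and q: "ereal r < q"
  obtains C where "0 < C" "\<And>n s T. 1 \<le> n \<Longrightarrow> 1 \<le> s \<Longrightarrow> T \<in> trig_polys n \<Longrightarrow> per_norm (ereal r) T = 1 \<Longrightarrow>
    per_norm q (nth_deriv s T) \<le> ereal (C * (real n ^ s * (1 + (real n / real s) powr real_of_ereal (1 / ereal r - 1 / q))))"
proof -
  define \<delta> where "\<delta> = real_of_ereal (1 / ereal r - 1 / q)"
  have \<delta>: "0 \<le> \<delta>"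
    unfolding \<delta>_def using q r by (cases q) (auto simp: one_ereal_def divide_simps)
  obtain K where K: "0 < K" 
    "\<And>n s c x. 1 \<le> n \<Longrightarrow> 1 \<le> s \<Longrightarrow> cmod ((deriv ^^ s) (trig_sum n c) (of_real x)) \<le>
       K * real n ^ s *
       poisson_mean (real s / real n) (\<lambda>t. cmod (trig_sum n c (of_real t)) powr r) x powr (1 / r)"
    using higher_deriv_le_poisson_mean[OF r] by metis
  show ?thesis
  proof (rule that[of "K * 4 powr \<delta>"])
    show "0 < K * 4 powr \<delta>" using K by simp
    fix n s :: nat and T assume n: "1 \<le> n" and s: "1 \<le> s" and T: "T \<in> trig_polys n" "per_norm (ereal r) T = 1"
    obtain c where c: "T = (\<lambda>x. trig_sum n c (of_real x))" using T(1) by (auto simp: trig_polys_eq)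
    define R where "R = real s / real n"
    have R: "0 < R" unfolding R_def using n s by simp
    define u where "u = (\<lambda>t. cmod (T t) powr r)"
    have contT: "continuous_on UNIV T" unfolding c by (intro continuous_intros)
    have u: "continuous_on UNIV u" "\<And>x. 0 \<le> u x"
      unfolding u_def using r by (intro continuous_on_powr' continuous_intros contT) auto
    have "integral {- pi..pi} u powr (1 / r) = 1"
      using T(2) unfolding per_norm_finite[OF r contT] u_def by (simp add: one_ereal_def)
    then have "(integral {- pi..pi} u powr (1 / r)) powr r = 1" by simp
    moreover have "0 \<le> integral {- pi..pi} u"
      using u by (intro Henstock_Kurzweil_Integration.integral_nonneg integrable_continuous_real continuous_on_subset[OF u(1)]) auto
    ultimately have int1: "integral {- pi..pi} u = 1"
      using r by (simp add: powr_powr)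
    have "per_norm q (nth_deriv s T) \<le> ereal (K * real n ^ s * (1 + 2 / R) powr \<delta>)"
      unfolding \<delta>_def
    proof (rule per_norm_le[OF r q])
      show "continuous_on UNIV (nth_deriv s T)"
        unfolding c nth_deriv_trig_sum by (intro continuous_intros)
      show "continuous_on UNIV (poisson_mean R u)" by (rule poisson_mean_continuous[OF R u(1)])
      show "integral {- pi..pi} (poisson_mean R u) \<le> 1"
        using integral_poisson_mean[OF R u(1)] int1 by simp
      show "0 \<le> poisson_mean R u x" "poisson_mean R u x \<le> 1 + 2 / R" for x
        using poisson_mean_le[OF R u] int1 by simp_all
      show "cmod (nth_deriv s T x) \<le> K * real n ^ s * poisson_mean R u x powr (1 / r)" for x
        using K(2)[OF n s, of c x] unfolding c nth_deriv_trig_sum higher_deriv_trig_sum u_def R_def .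
    qed (use K in simp)
    also have "(1 + 2 / R) powr \<delta> \<le> 4 powr \<delta> * (1 + (real n / real s) powr \<delta>)"
    proof (cases "real n / real s \<le> 1")
      case True
      then have "(1 + 2 / R) powr \<delta> \<le> 4 powr \<delta>"
        unfolding R_def using \<delta> n s by (intro powr_mono2) (auto simp: field_simps)
      also have "\<dots> \<le> 4 powr \<delta> * (1 + (real n / real s) powr \<delta>)" by simp
      finally show ?thesis .
    next
      case False
      then have "(1 + 2 / R) powr \<delta> \<le> (4 * (real n / real s)) powr \<delta>"
        unfolding R_def using \<delta> n s by (intro powr_mono2) (auto simp: field_simps)
      also have "\<dots> = 4 powr \<delta> * (real n / real s) powr \<delta>" by (rule powr_mult)
      also have "\<dots> \<le> 4 powr \<delta> * (1 + (real n / real s) powr \<delta>)" by simp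
      finally show ?thesis .
    qed
    then have "ereal (K * real n ^ s * (1 + 2 / R) powr \<delta>)
      \<le> ereal (K * real n ^ s * (4 powr \<delta> * (1 + (real n / real s) powr \<delta>)))"
      using K by (simp add: mult_left_mono)
    finally show "per_norm q (nth_deriv s T) \<le> ereal (K * 4 powr \<delta> * (real n ^ s * (1 + (real n / real s) powr real_of_ereal (1 / ereal r - 1 / q))))"
      unfolding \<delta>_def by (simp add: mult_ac)
  qed
qed

section \<open>Lower bound\<close>

lemma geometric_power_coeffs:
  obtains P :: "complex poly" where "degree P \<le> N * (m - 1)" "\<And>i. coeff P i \<in> \<real>\<^sub>\<ge>\<^sub>0"
    "\<And>z. poly P z = (\<Sum>j<m. z ^ j) ^ N"
proof
  define D :: "complex poly" where "D = (\<Sum>j<m. monom 1 j)"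
  show "poly (D ^ N) z = (\<Sum>j<m. z ^ j) ^ N" for z
    unfolding D_def by (simp add: poly_power poly_sum poly_monom)
  have "degree D \<le> m - 1"
    unfolding D_def by (rule degree_sum_le) (auto intro: order_trans[OF degree_monom_le])
  then show "degree (D ^ N) \<le> N * (m - 1)"
    using degree_power_le[of D N] by (metis mult.commute mult_le_mono1 order_trans)
  have sum: "sum f A \<in> \<real>\<^sub>\<ge>\<^sub>0" if "\<And>x. x \<in> A \<Longrightarrow> f x \<in> \<real>\<^sub>\<ge>\<^sub>0" for f :: "nat \<Rightarrow> complex" and A
    using that by (induction A rule: infinite_finite_induct) auto
  have D: "coeff D i \<in> \<real>\<^sub>\<ge>\<^sub>0" for i
    unfolding D_def coeff_sum by (intro sum) auto
  show "coeff (D ^ N) i \<in> \<real>\<^sub>\<ge>\<^sub>0" for i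
  proof (induction N arbitrary: i)
    case (Suc N)
    then show ?case unfolding power_Suc coeff_mult by (intro sum nonneg_Reals_mult_I D)
  qed auto
qed

lemma sum_shifted_coeffs:
  fixes a :: "nat \<Rightarrow> complex"
  assumes "n0 + d = n"
  shows "(\<Sum>k = - int n..int n. (if int n0 \<le> k then a (nat (k - int n0)) else 0) * \<phi> k) = (\<Sum>i\<le>d. a i * \<phi> (int (n0 + i)))"
proof -
  have "(\<Sum>k = - int n..int n. (if int n0 \<le> k then a (nat (k - int n0)) else 0) * \<phi> k)
      = (\<Sum>k = int n0..int n. a (nat (k - int n0)) * \<phi> k)"
    by (rule sum.mono_neutral_cong_right) auto
  also have "\<dots> = (\<Sum>i\<le>d. a i * \<phi> (int (n0 + i)))"
    using assms by (intro sum.reindex_bij_witness[of _ "\<lambda>i. int (n0 + i)" "\<lambda>k. nat (k - int n0)"]) auto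
  finally show ?thesis .
qed

lemma norm_dirichlet_le: "cmod (\<Sum>j<m. cis x ^ j) \<le> real m"
  by (rule order_trans[OF norm_sum]) (simp add: norm_power)

lemma has_integral_dirichlet_square:
  "((\<lambda>x. (cmod (\<Sum>j<m. cis x ^ j))\<^sup>2) has_integral 2 * pi * real m) {- pi..pi}"
proof -
  have eq: "(cmod (\<Sum>j<m. cis x ^ j))\<^sup>2 = (\<Sum>j<m. \<Sum>l<m. cos (real_of_int (int j - int l) * x))" for x
  proof -
    have "complex_of_real ((cmod (\<Sum>j<m. cis x ^ j))\<^sup>2) = (\<Sum>j<m. cis x ^ j) * cnj (\<Sum>j<m. cis x ^ j)"
      by (rule complex_norm_square)
    also have "\<dots> = (\<Sum>j<m. \<Sum>l<m. cis (real_of_int (int j - int l) * x))"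
      by (simp add: sum_product Complex.DeMoivre cis_cnj cis_mult algebra_simps)
    finally have "Re (complex_of_real ((cmod (\<Sum>j<m. cis x ^ j))\<^sup>2)) = Re (\<Sum>j<m. \<Sum>l<m. cis (real_of_int (int j - int l) * x))"
      by (rule arg_cong)
    then show ?thesis by simp
  qed
  have "((\<lambda>x. \<Sum>j<m. \<Sum>l<m. cos (real_of_int (int j - int l) * x)) has_integral
      (\<Sum>j<m. \<Sum>l<m. if int j - int l = 0 then 2 * pi else 0)) {- pi..pi}"
    by (intro has_integral_sum has_integral_cos_nx finite_lessThan)
  also have "(\<Sum>j<m. \<Sum>l<m. if int j - int l = 0 then 2 * pi else 0) = 2 * pi * real m"
    by (simp add: sum.delta)
  finally show ?thesis unfolding eq .
qed

text \<open>
  Bound \<open>\<alpha> - 2\<close> of the \<open>\<alpha>\<close> factors by the maximum \<open>m\<close>, and apply Parseval's identity to the remaining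
  square.
\<close>
lemma integral_dirichlet_powr_le:
  assumes \<alpha>: "2 \<le> \<alpha>"
  shows "integral {- pi..pi} (\<lambda>x. cmod (\<Sum>j<m. cis x ^ j) powr \<alpha>) \<le> 2 * pi * real m powr (\<alpha> - 1)"
proof -
  have "integral {- pi..pi} (\<lambda>x. cmod (\<Sum>j<m. cis x ^ j) powr \<alpha>) \<le> real m powr (\<alpha> - 2) * (2 * pi * real m)"
  proof (rule has_integral_le[OF integrable_integral])
    show "(\<lambda>x. cmod (\<Sum>j<m. cis x ^ j) powr \<alpha>) integrable_on {- pi..pi}"
      using \<alpha> by (intro integrable_continuous_real continuous_on_powr' continuous_intros) auto
    show "((\<lambda>x. real m powr (\<alpha> - 2) * (cmod (\<Sum>j<m. cis x ^ j))\<^sup>2) has_integral real m powr (\<alpha> - 2) * (2 * pi * real m)) {- pi..pi}"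
      by (intro has_integral_mult_right has_integral_dirichlet_square)
    fix x
    define y where "y = cmod (\<Sum>j<m. cis x ^ j)"
    have y: "0 \<le> y" "y \<le> real m" unfolding y_def using norm_dirichlet_le by auto
    have "y powr \<alpha> = y powr (\<alpha> - 2) * y\<^sup>2"
      using y powr_add[of y "\<alpha> - 2" 2] by (cases "y = 0") (auto simp: powr_numeral)
    also have "\<dots> \<le> real m powr (\<alpha> - 2) * y\<^sup>2"
      using \<alpha> y by (intro mult_right_mono powr_mono2) auto
    finally show "cmod (\<Sum>j<m. cis x ^ j) powr \<alpha> \<le> real m powr (\<alpha> - 2) * (cmod (\<Sum>j<m. cis x ^ j))\<^sup>2"
      unfolding y_def .
  qed
  also have "\<dots> = 2 * pi * real m powr (\<alpha> - 1)"
    using powr_add[of "real m" "\<alpha> - 2" 1] by (cases "m = 0") auto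
  finally show ?thesis .
qed

lemma per_norm_ge:
  assumes q: "0 < q" and f: "continuous_on UNIV f" and \<delta>: "0 < \<delta>" "\<delta> \<le> 1" and B: "0 \<le> B"
    and ge: "\<And>x. \<bar>x\<bar> \<le> \<delta> \<Longrightarrow> B \<le> cmod (f x)"
  shows "ereal (B * (2 * \<delta>) powr real_of_ereal (1 / q)) \<le> per_norm q f"
proof (cases "q = \<infinity>")
  case True
  define M where "M = lebesgue_on {- pi..pi}"
  have sub: "{- \<delta>..\<delta>} \<subseteq> {- pi..pi}" using \<delta> pi_gt3 by auto
  have "ereal B \<le> esssup M (\<lambda>x. ereal (cmod (f x)))"
  proof (rule ccontr)
    assume "\<not> ereal B \<le> esssup M (\<lambda>x. ereal (cmod (f x)))"
    then have less: "esssup M (\<lambda>x. ereal (cmod (f x))) < ereal B" by simp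
    have "AE x in M. ereal (cmod (f x)) \<le> esssup M (\<lambda>x. ereal (cmod (f x)))" by (rule esssup_AE)
    then have "AE x in M. x \<notin> {- \<delta>..\<delta>}"
    proof eventually_elim
      case (elim x)
      from le_less_trans[OF this less] have "ereal (cmod (f x)) < ereal B" .
      moreover have "\<bar>x\<bar> \<le> \<delta>" if "x \<in> {- \<delta>..\<delta>}" using that unfolding atLeastAtMost_iff by linarith
      ultimately show ?case using ge[of x] by force
    qed
    moreover have "{x \<in> space M. \<not> x \<notin> {- \<delta>..\<delta>}} = {- \<delta>..\<delta>}"
      using sub unfolding M_def by (auto simp: space_restrict_space)
    moreover have sets: "{- \<delta>..\<delta>} \<in> sets M"
      using sub unfolding M_def by (auto simp: sets_restrict_space_iff)
    ultimately have "emeasure M {- \<delta>..\<delta>} = 0"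
      by (subst (asm) AE_iff_measurable) auto
    moreover have "emeasure M {- \<delta>..\<delta>} = ennreal (2 * \<delta>)"
      unfolding M_def using sub \<delta> by (subst emeasure_restrict_space) auto
    ultimately show False using \<delta> by simp
  qed
  then show ?thesis unfolding per_norm_def M_def using True \<delta> by simp
next
  case False
  then obtain v where v: "q = ereal v" "0 < v" using q by (cases q) auto
  have cont: "(\<lambda>x. cmod (f x) powr v) integrable_on {a..b}" for a b
    using v by (intro integrable_continuous_real continuous_on_powr' continuous_intros continuous_on_subset[OF f]) auto
  have "B powr v * (2 * \<delta>) = integral {- \<delta>..\<delta>} (\<lambda>x. B powr v)"
    using \<delta> by (simp add: mult.commute)
  also have "\<dots> \<le> integral {- \<delta>..\<delta>} (\<lambda>x. cmod (f x) powr v)"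
    using v B ge by (intro integral_le cont powr_mono2) auto
  also have "\<dots> \<le> integral {- pi..pi} (\<lambda>x. cmod (f x) powr v)"
    using \<delta> pi_gt3 by (intro integral_subset_le cont) auto
  finally have "(B powr v * (2 * \<delta>)) powr (1 / v) \<le> integral {- pi..pi} (\<lambda>x. cmod (f x) powr v) powr (1 / v)"
    using v \<delta> by (intro powr_mono2) auto
  also have "(B powr v * (2 * \<delta>)) powr (1 / v) = B * (2 * \<delta>) powr (1 / v)"
    using v B \<delta> by (simp add: powr_mult powr_powr)
  finally show ?thesis unfolding v per_norm_finite[OF v(2) f] using v by (simp add: one_ereal_def)
qed

lemma cos_ge_half:
  assumes "\<bar>x\<bar> \<le> (1::real)" shows "1 / 2 \<le> cos x"
proof -
  have "cos (pi / 3) \<le> cos \<bar>x\<bar>"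
    using assms pi_gt3 by (intro cos_monotone_0_pi_le) auto
  then show ?thesis by (simp add: cos_60)
qed

text \<open>
  After division by \<open>i\<^sup>s exp (i n0 x)\<close> the sum has nonnegative coefficients and frequencies between \<open>0\<close> and
  \<open>d\<close>. For \<open>d |x| \<le> 1\<close> the real part of each term is then at least half of its modulus.
\<close>
lemma nonneg_sum_lower:
  assumes a: "\<And>i. a i \<in> \<real>\<^sub>\<ge>\<^sub>0" and x: "real d * \<bar>x\<bar> \<le> 1"
  shows "real n0 ^ s / 2 * Re (\<Sum>i\<le>d. a i)
    \<le> cmod (\<Sum>i\<le>d. a i * (\<i> * of_int (int (n0 + i))) ^ s * exp (\<i> * of_int (int (n0 + i)) * of_real x))"
proof -
  define \<alpha> where "\<alpha> = (\<lambda>i. Re (a i))"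
  have a': "a i = of_real (\<alpha> i)" "0 \<le> \<alpha> i" for i
    using a[of i] unfolding \<alpha>_def by (auto simp: complex_nonneg_Reals_iff complex_eq_iff)
  define S where "S = (\<Sum>i\<le>d. of_real (\<alpha> i * real (n0 + i) ^ s) * cis (real i * x))"
  have "(\<Sum>i\<le>d. a i * (\<i> * of_int (int (n0 + i))) ^ s * exp (\<i> * of_int (int (n0 + i)) * of_real x))
      = \<i> ^ s * cis (real n0 * x) * S"
    unfolding S_def sum_distrib_left
  proof (intro sum.cong refl)
    fix i
    have "exp (\<i> * of_int (int (n0 + i)) * of_real x) = cis (real n0 * x) * cis (real i * x)"
      unfolding cis_conv_exp mult_exp_exp by (simp add: algebra_simps)
    moreover have "(\<i> * of_int (int (n0 + i))) ^ s = \<i> ^ s * of_real (real (n0 + i) ^ s)"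
      unfolding power_mult_distrib by simp
    ultimately show "a i * (\<i> * of_int (int (n0 + i))) ^ s * exp (\<i> * of_int (int (n0 + i)) * of_real x)
        = \<i> ^ s * cis (real n0 * x) * (of_real (\<alpha> i * real (n0 + i) ^ s) * cis (real i * x))"
      unfolding a' of_real_mult by (simp only: mult_ac)
  qed
  then have "cmod (\<Sum>i\<le>d. a i * (\<i> * of_int (int (n0 + i))) ^ s * exp (\<i> * of_int (int (n0 + i)) * of_real x)) = cmod S"
    by (simp add: norm_mult norm_power)
  also have "\<dots> \<ge> Re S" by (rule complex_Re_le_cmod)
  also have "Re S = (\<Sum>i\<le>d. \<alpha> i * real (n0 + i) ^ s * cos (real i * x))"
    unfolding S_def by simp
  also have "\<dots> \<ge> (\<Sum>i\<le>d. \<alpha> i * real n0 ^ s * (1 / 2))"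
  proof (intro sum_mono mult_mono)
    fix i assume "i \<in> {..d}"
    then have "\<bar>real i * x\<bar> \<le> real d * \<bar>x\<bar>" unfolding abs_mult by (intro mult_mono) auto
    then show "1 / 2 \<le> cos (real i * x)" using x by (intro cos_ge_half) linarith
  qed (auto intro!: power_mono simp: a')
  also have "(\<Sum>i\<le>d. \<alpha> i * real n0 ^ s * (1 / 2)) = real n0 ^ s / 2 * Re (\<Sum>i\<le>d. a i)"
    unfolding \<alpha>_def by (simp add: sum_distrib_left sum_divide_distrib mult_ac)
  finally show ?thesis .
qed

text \<open>
  With \<open>d = N (m - 1)\<close> and \<open>2 s d \<le> n\<close>, Bernoulli's inequality gives \<open>(n - d)\<^sup>s \<ge> n\<^sup>s / 2\<close>. The \<open>s\<close>-th derivative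
  of the test function is therefore at least \<open>n\<^sup>s m\<^sup>N / 4\<close> on an interval of length about \<open>1/m\<close>, while the norm of
  the test function is at most a multiple of \<open>m\<close> to the power \<open>N - 1/r\<close>. The quotient is a multiple of \<open>n\<^sup>s\<close> times
  \<open>m\<close> to the power \<open>\<delta> = 1/r - 1/q\<close>, and both \<open>m \<ge> 1\<close> and \<open>m \<ge> n / (2 s N)\<close>, one for each term of the claim.
\<close>
lemma nikolskii_bernstein_lower:
  assumes r: "0 < r" and q: "ereal r < q"
  obtains C where "0 < C" "\<And>n s. 1 \<le> n \<Longrightarrow> 1 \<le> s \<Longrightarrow> \<exists>T \<in> trig_polys n. per_norm (ereal r) T = 1 \<and>
    ereal (C * (real n ^ s * (1 + (real n / real s) powr real_of_ereal (1 / ereal r - 1 / q)))) \<le> per_norm q (nth_deriv s T)"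
proof -
  define \<kappa> where "\<kappa> = real_of_ereal (1 / q)"
  define \<delta> where "\<delta> = real_of_ereal (1 / ereal r - 1 / q)"
  have q0: "0 < q" using r q by (meson ereal_less(2) less_trans)
  have \<delta>: "0 \<le> \<delta>" "\<delta> = 1 / r - \<kappa>" and \<kappa>: "0 \<le> \<kappa>"
    unfolding \<delta>_def \<kappa>_def using q r by (cases q; auto simp: one_ereal_def divide_simps)+
  define N where "N = nat \<lceil>2 / r\<rceil>"
  have "2 / r \<le> real N" unfolding N_def by linarith
  then have N: "2 \<le> real N * r" using r by (simp add: field_simps)
  then have N0: "0 < N" by (cases N) auto
  define c1 where "c1 = 1 / (4 * (2 * pi) powr (1 / r) * real N powr \<kappa>)"
  have c1: "0 < c1" unfolding c1_def using N0 by simp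
  show ?thesis
  proof (rule that[of "c1 / (1 + (2 * real N) powr \<delta>)"])
    show "0 < c1 / (1 + (2 * real N) powr \<delta>)" using c1 by (simp add: add_pos_nonneg)
    fix n s :: nat
    assume n: "1 \<le> n" and s: "1 \<le> s"
    \<comment> \<open>for \<open>n < 2 s N\<close> this is \<open>m = 1\<close>, and the test function is \<open>exp (i n x)\<close>\<close>
    define m where "m = Suc (n div (2 * s * N))"
    define d where "d = N * (m - 1)"
    define n0 where "n0 = n - d"
    have m0: "0 < m" unfolding m_def by simp
    have ds: "d * (2 * s) \<le> n"
    proof -
      have "d * (2 * s) = (n div (2 * s * N)) * (2 * s * N)" unfolding d_def m_def by simp
      also have "\<dots> \<le> n" by (rule div_times_less_eq_dividend)
      finally show ?thesis .
    qed
    have dn: "d \<le> n"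
      by (rule order_trans[OF _ ds]) (use s in simp)
    have n0: "n0 + d = n" unfolding n0_def using dn by simp
    have mn: "real n / real s \<le> 2 * real N * real m"
    proof -
      have "n < m * (2 * s * N)"
        unfolding m_def using N0 s dividend_less_div_times[of "2 * s * N" n] by simp
      then have "real n \<le> real (m * (2 * s * N))" by (intro of_nat_mono) simp
      then show ?thesis using s by (simp add: field_simps)
    qed
    obtain P :: "complex poly" where P: "degree P \<le> d" "\<And>i. coeff P i \<in> \<real>\<^sub>\<ge>\<^sub>0"
      "\<And>z. poly P z = (\<Sum>j<m. z ^ j) ^ N"
      unfolding d_def using geometric_power_coeffs by metis
    have polyP: "poly P z = (\<Sum>i\<le>d. coeff P i * z ^ i)" for z
      unfolding poly_altdef using P(1)
      by (intro sum.mono_neutral_left) (auto simp: coeff_eq_0)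
    define c where "c = (\<lambda>k. if int n0 \<le> k then coeff P (nat (k - int n0)) else 0)"
    define \<eta> where "\<eta> = 1 / (real N * real m)"
    have \<eta>: "0 < \<eta>" "\<eta> \<le> 1" unfolding \<eta>_def using N0 m0
      by (auto simp: field_simps) (metis Suc_leI mult_pos_pos of_nat_1 of_nat_le_iff of_nat_mult One_nat_def)
    have ratio: "real n0 ^ s \<ge> real n ^ s / 2"
    proof -
      have "real (d * (2 * s)) \<le> real n" using ds by (rule of_nat_mono)
      then have "real d \<le> real n / (2 * real s)" using s by (simp add: field_simps)
      moreover have "real n0 = real n - real d" using n0 by linarith
      ultimately have "real n * (1 + - (1 / (2 * real s))) \<le> real n0" by (simp add: algebra_simps)
      then have "(real n * (1 + - (1 / (2 * real s)))) ^ s \<le> real n0 ^ s"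
        using s by (intro power_mono mult_nonneg_nonneg) (auto simp: field_simps)
      moreover have "1 + real s * - (1 / (2 * real s)) \<le> (1 + - (1 / (2 * real s))) ^ s"
        using s by (intro Bernoulli_inequality) (auto simp: field_simps)
      then have "1 / 2 \<le> (1 + - (1 / (2 * real s))) ^ s" using s by simp
      then have "real n ^ s * (1 / 2) \<le> real n ^ s * (1 + - (1 / (2 * real s))) ^ s"
        by (intro mult_left_mono) auto
      ultimately show ?thesis by (simp add: power_mult_distrib)
    qed
    have low: "real n0 ^ s' / 2 * real m ^ N \<le> cmod (trig_sum n (\<lambda>k. c k * (\<i> * of_int k) ^ s') (of_real x))"
      if x: "\<bar>x\<bar> \<le> \<eta>" for x s'
    proof -
      have "d \<le> N * m" unfolding d_def by simp
      then have "real d \<le> real N * real m" by (metis of_nat_le_iff of_nat_mult)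
      then have "real d * \<bar>x\<bar> \<le> (real N * real m) * \<eta>" using x by (intro mult_mono) auto
      also have "\<dots> = 1" unfolding \<eta>_def using N0 m0 by simp
      finally have "real n0 ^ s' / 2 * Re (\<Sum>i\<le>d. coeff P i)
          \<le> cmod (\<Sum>i\<le>d. coeff P i * (\<i> * of_int (int (n0 + i))) ^ s' * exp (\<i> * of_int (int (n0 + i)) * of_real x))"
        by (rule nonneg_sum_lower[OF P(2)])
      also have "(\<Sum>i\<le>d. coeff P i) = of_real (real m ^ N)"
        using polyP[of 1] P(3)[of 1] by simp
      also have "(\<Sum>i\<le>d. coeff P i * (\<i> * of_int (int (n0 + i))) ^ s' * exp (\<i> * of_int (int (n0 + i)) * of_real x))
          = trig_sum n (\<lambda>k. c k * (\<i> * of_int k) ^ s') (of_real x)"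
        unfolding trig_sum_def c_def mult.assoc
        by (rule sum_shifted_coeffs[OF n0, symmetric])
      finally show ?thesis by simp
    qed
    have normT0: "cmod (trig_sum n c (of_real x)) = cmod (\<Sum>j<m. cis x ^ j) ^ N" for x
    proof -
      have "trig_sum n c (of_real x) = (\<Sum>i\<le>d. coeff P i * exp (\<i> * of_int (int (n0 + i)) * of_real x))"
        unfolding trig_sum_def c_def by (rule sum_shifted_coeffs[OF n0])
      also have "\<dots> = cis (real n0 * x) * poly P (cis x)"
        unfolding polyP sum_distrib_left
      proof (intro sum.cong refl)
        fix i
        have "exp (\<i> * of_int (int (n0 + i)) * of_real x) = cis (real n0 * x) * cis (real i * x)"
          unfolding cis_conv_exp mult_exp_exp by (simp add: algebra_simps)
        then show "coeff P i * exp (\<i> * of_int (int (n0 + i)) * of_real x) = cis (real n0 * x) * (coeff P i * cis x ^ i)"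
          unfolding Complex.DeMoivre by simp
      qed
      finally show ?thesis unfolding P(3) by (simp add: norm_mult norm_power)
    qed
    define I where "I = integral {- pi..pi} (\<lambda>x. cmod (trig_sum n c (of_real x)) powr r)"
    have contT0: "continuous_on UNIV (\<lambda>x. trig_sum n c (of_real x))" by (intro continuous_intros)
    define \<nu> where "\<nu> = I powr (1 / r)"
    \<comment> \<open>the lower bound for the derivative of order \<open>0\<close> shows that the norm is not \<open>0\<close>\<close>
    have "ereal (real n0 ^ 0 / 2 * real m ^ N * (2 * \<eta>) powr real_of_ereal (1 / ereal r)) \<le> per_norm (ereal r) (\<lambda>x. trig_sum n c (of_real x))"
      using r low[of _ 0] by (intro per_norm_ge contT0 \<eta>) auto
    then have "real n0 ^ 0 / 2 * real m ^ N * (2 * \<eta>) powr real_of_ereal (1 / ereal r) \<le> \<nu>"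
      unfolding per_norm_finite[OF r contT0] \<nu>_def I_def by simp
    moreover have "0 < real n0 ^ 0 / 2 * real m ^ N * (2 * \<eta>) powr real_of_ereal (1 / ereal r)"
      using m0 \<eta> by simp
    ultimately have "0 < \<nu>" by linarith
    have "0 \<le> I"
      unfolding I_def using r
      by (intro Henstock_Kurzweil_Integration.integral_nonneg integrable_continuous_real
          continuous_on_powr' continuous_intros) auto
    with \<open>0 < \<nu>\<close> have I0: "0 < I" unfolding \<nu>_def by (cases "I = 0") auto
    have "I = integral {- pi..pi} (\<lambda>x. cmod (\<Sum>j<m. cis x ^ j) powr (real N * r))"
    proof -
      have "(y ^ N) powr r = y powr (real N * r)" if "0 \<le> y" for y :: real
        using that N0 by (cases "y = 0") (auto simp: powr_powr powr_realpow [symmetric])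
      then show ?thesis unfolding I_def normT0 by simp
    qed
    also have "\<dots> \<le> 2 * pi * real m powr (real N * r - 1)"
      by (rule integral_dirichlet_powr_le[OF N])
    finally have I_le: "I \<le> 2 * pi * real m powr (real N * r - 1)" .
    have "\<nu> \<le> (2 * pi * real m powr (real N * r - 1)) powr (1 / r)"
      unfolding \<nu>_def using r I0 by (intro powr_mono2 I_le) auto
    also have "\<dots> = (2 * pi) powr (1 / r) * real m powr (real N - 1 / r)"
      using r by (simp add: powr_mult powr_powr diff_divide_distrib)
    also have "real m powr (real N - 1 / r) = real m ^ N / real m powr (1 / r)"
      using m0 by (simp add: powr_diff powr_realpow)
    finally have \<nu>_le: "\<nu> \<le> (2 * pi) powr (1 / r) * (real m ^ N / real m powr (1 / r))" .
    define T where "T = (\<lambda>x. trig_sum n (\<lambda>k. c k / of_real \<nu>) (of_real x))"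
    have scale: "trig_sum n (\<lambda>k. a k / of_real \<nu>) z = trig_sum n a z / of_real \<nu>" for a z
      unfolding trig_sum_def by (simp add: sum_divide_distrib)
    have contT: "continuous_on UNIV T" unfolding T_def by (intro continuous_intros)
    have "T \<in> trig_polys n" unfolding T_def trig_polys_eq by blast
    moreover have "per_norm (ereal r) T = 1"
    proof -
      have "integral {- pi..pi} (\<lambda>x. cmod (T x) powr r) = I / \<nu> powr r"
        unfolding T_def scale I_def norm_divide using \<open>0 < \<nu>\<close> by (simp add: powr_divide)
      also have "\<nu> powr r = I" unfolding \<nu>_def using r I0 by (simp add: powr_powr)
      finally show ?thesis unfolding per_norm_finite[OF r contT] using I0 by (simp add: one_ereal_def)
    qed
    moreover have "ereal (c1 / (1 + (2 * real N) powr \<delta>) * (real n ^ s * (1 + (real n / real s) powr \<delta>))) \<le> per_norm q (nth_deriv s T)"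
    proof -
      define B where "B = real n0 ^ s / 2 * real m ^ N"
      have B0: "0 \<le> B" unfolding B_def by simp
      have derT: "nth_deriv s T = (\<lambda>x. trig_sum n (\<lambda>k. c k * (\<i> * of_int k) ^ s) (of_real x) / of_real \<nu>)"
        unfolding T_def nth_deriv_trig_sum scale [symmetric] by simp
      have "ereal (B / \<nu> * (2 * \<eta>) powr \<kappa>) \<le> per_norm q (nth_deriv s T)"
        unfolding \<kappa>_def
      proof (rule per_norm_ge[OF q0 _ \<eta>])
        show "continuous_on UNIV (nth_deriv s T)"
          unfolding T_def nth_deriv_trig_sum by (intro continuous_intros)
        show "0 \<le> B / \<nu>" unfolding B_def using \<open>0 < \<nu>\<close> by simp
        show "B / \<nu> \<le> cmod (nth_deriv s T x)" if "\<bar>x\<bar> \<le> \<eta>" for x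
          using divide_right_mono[OF low[OF that, of s], of \<nu>] \<open>0 < \<nu>\<close> unfolding derT B_def norm_divide by simp
      qed
      moreover have "c1 / (1 + (2 * real N) powr \<delta>) * (real n ^ s * (1 + (real n / real s) powr \<delta>)) \<le> B / \<nu> * (2 * \<eta>) powr \<kappa>"
      proof -
        have "1 + (real n / real s) powr \<delta> \<le> real m powr \<delta> + (2 * real N * real m) powr \<delta>"
          using mn m0 \<delta> by (intro add_mono powr_mono2 ge_one_powr_ge_zero) auto
        also have "\<dots> = (1 + (2 * real N) powr \<delta>) * real m powr \<delta>"
          by (simp add: powr_mult algebra_simps)
        finally have 1: "(1 + (real n / real s) powr \<delta>) / (1 + (2 * real N) powr \<delta>) \<le> real m powr \<delta>"
          by (subst pos_divide_le_eq) (auto simp: mult.commute add_pos_nonneg)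
        have "c1 / (1 + (2 * real N) powr \<delta>) * (real n ^ s * (1 + (real n / real s) powr \<delta>))
            = c1 * real n ^ s * ((1 + (real n / real s) powr \<delta>) / (1 + (2 * real N) powr \<delta>))" by simp
        also have "\<dots> \<le> c1 * real n ^ s * real m powr \<delta>"
          using c1 by (intro mult_left_mono 1) auto
        also have "\<dots> = (real n ^ s / 4 * real m ^ N / ((2 * pi) powr (1 / r) * (real m ^ N / real m powr (1 / r)))) * \<eta> powr \<kappa>"
          unfolding c1_def \<eta>_def \<delta>(2) using m0 N0 by (simp add: powr_diff powr_divide powr_mult)
        also have "\<dots> \<le> (B / \<nu>) * (2 * \<eta>) powr \<kappa>"
        proof (intro mult_mono frac_le)
          show "real n ^ s / 4 * real m ^ N \<le> B"
            unfolding B_def using ratio by (intro mult_right_mono) auto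
          show "\<eta> powr \<kappa> \<le> (2 * \<eta>) powr \<kappa>" using \<eta> \<kappa> by (intro powr_mono2) auto
        qed (use \<open>0 < \<nu>\<close> \<nu>_le B0 in auto)
        finally show ?thesis .
      qed
      ultimately show ?thesis by (meson ereal_less_eq(3) order_trans)
    qed
    ultimately show "\<exists>T \<in> trig_polys n. per_norm (ereal r) T = 1 \<and>
      ereal (c1 / (1 + (2 * real N) powr \<delta>) * (real n ^ s * (1 + (real n / real s) powr real_of_ereal (1 / ereal r - 1 / q)))) \<le> per_norm q (nth_deriv s T)"
      unfolding \<delta>_def by blast
  qed
qed

section \<open>The two-sided estimate\<close>

theorem theorem1p1:
  fixes p q :: ereal
  assumes "0 < p" and "p < q"
  shows "\<exists>C1 C2 :: real. C1 > 0 \<and> C2 > 0 \<and>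
    (\<forall>n s :: nat. n \<ge> 1 \<longrightarrow> s \<ge> 1 \<longrightarrow>
      (let A = (SUP T \<in> {T \<in> trig_polys n. per_norm p T = 1}. per_norm q (nth_deriv s T));
           B = real n ^ s * (1 + (real n / real s) powr real_of_ereal (1 / p - 1 / q))
       in ereal (C2 * B) \<le> A \<and> A \<le> ereal (C1 * B)))"
proof -
  obtain r where r: "p = ereal r" "0 < r" using assms by (cases p) auto
  have q: "ereal r < q" using assms r by simp
  obtain C1 where C1: "0 < C1" "\<And>n s T. 1 \<le> n \<Longrightarrow> 1 \<le> s \<Longrightarrow> T \<in> trig_polys n \<Longrightarrow> per_norm (ereal r) T = 1 \<Longrightarrow>
    per_norm q (nth_deriv s T) \<le> ereal (C1 * (real n ^ s * (1 + (real n / real s) powr real_of_ereal (1 / ereal r - 1 / q))))"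
    using nikolskii_bernstein_upper[OF r(2) q] by metis
  obtain C2 where C2: "0 < C2" "\<And>n s. 1 \<le> n \<Longrightarrow> 1 \<le> s \<Longrightarrow> \<exists>T \<in> trig_polys n. per_norm (ereal r) T = 1 \<and>
    ereal (C2 * (real n ^ s * (1 + (real n / real s) powr real_of_ereal (1 / ereal r - 1 / q)))) \<le> per_norm q (nth_deriv s T)"
    using nikolskii_bernstein_lower[OF r(2) q] by metis
  show ?thesis
    unfolding Let_def r(1)
  proof (rule exI[of _ C1], rule exI[of _ C2], intro conjI allI impI C1(1) C2(1))
    fix n s :: nat
    assume n: "1 \<le> n" and s: "1 \<le> s"
    obtain T where T: "T \<in> trig_polys n" "per_norm (ereal r) T = 1"
      "ereal (C2 * (real n ^ s * (1 + (real n / real s) powr real_of_ereal (1 / ereal r - 1 / q)))) \<le> per_norm q (nth_deriv s T)"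
      using C2(2)[OF n s] by blast
    show "ereal (C2 * (real n ^ s * (1 + (real n / real s) powr real_of_ereal (1 / ereal r - 1 / q))))
        \<le> (SUP T \<in> {T \<in> trig_polys n. per_norm (ereal r) T = 1}. per_norm q (nth_deriv s T))"
      using T by (intro SUP_upper2[of T]) auto
    show "(SUP T \<in> {T \<in> trig_polys n. per_norm (ereal r) T = 1}. per_norm q (nth_deriv s T))
        \<le> ereal (C1 * (real n ^ s * (1 + (real n / real s) powr real_of_ereal (1 / ereal r - 1 / q))))"
      using C1(2)[OF n s] by (intro SUP_least) auto
  qed
qed

end
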